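(* Let $k$ be a complete valuation field such that $|k|$ is dense in $\mathbb{R}_{\geq 0}$, and let $\kappa$ be either an infinite cardinal or the class $\mathrm{Ord}$, satisfying the non-measurability condition. Then the Banach $k$-vector space $\mathrm{C}_{\mathrm{bd}}(\mathbb{Q},k)$ of bounded continuous functions $\mathbb{Q}\to k$, equipped with the supremum norm, does not belong to $\mathscr{R}$, the Reid class of Banach $k$-vector spaces with respect to $\kappa$.
   Context: A complete valuation field is a field $k$ with a complete non-Archimedean absolute value $|\cdot|\colon k\to\mathbb{R}_{\geq 0}$; $|k|$ denotes its image. $\mathbb{Q}$ carries the usual topology (induced from $\mathbb{R}$). $\mathrm{Ban}(k)$ is the class of (non-Archimedean, i.e. ultrametric) Banach $k$-vector spaces; $\cong$ means isometric $k$-linear isomorphism. For a set $I$ and a family $\mathcal{W}\in\mathrm{Ban}(k)^I$, $\Pi_I\mathcal{W}$ is the bounded direct product: all $w=(w(i))_{i\in I}$ with $w(i)\in\mathcal{W}(i)$ and $\sup_{i\in I}\|w(i)\|<\infty$, with the supremum norm. $\Sigma_I\mathcal{W}$ is the completed direct sum: the closed subspace of those $w\in\Pi_I\mathcal{W}$ such that $\{i\in I:\|w(i)\|\geq\epsilon\}$ is finite for every $\epsilon>0$. $F_k$ is the class of Banach spaces isomorphic to $k^n$ with the maximum norm for some integer $n\geq 0$. "$\#I<\kappa$" means the cardinality of the set $I$ belongs to $\kappa$ (no restriction if $\kappa=\mathrm{Ord}$). Reid hierarchy: by recursion on the ordinal $\alpha$, $\mathscr{R}_{<\alpha}=\bigcup_{\beta<\alpha}\mathscr{R}_{\beta}$;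 $\Pi_{\alpha}$ is $F_k$ together with all $V\in\mathrm{Ban}(k)$ such that $V\cong\Pi_I\mathcal{W}$ for some set $I$ with $\#I<\kappa$ and some $\mathcal{W}\in(\mathscr{R}_{<\alpha})^I$; $\Sigma_{\alpha}$ is $F_k$ together with all $V$ such that $V\cong\Sigma_I\mathcal{W}$ for some such $I$, $\mathcal{W}$; $\mathscr{R}_{\alpha}=\Pi_{\alpha}\cup\Sigma_{\alpha}$. Reid class is $\mathscr{R}=\bigcup_{\alpha\in\mathrm{Ord}}\mathscr{R}_{\alpha}$. A set $X$ is $\omega_1$-measurable if it is uncountable and admits a non-principal ultrafilter closed under countable intersections; $\kappa$ satisfies the non-measurability condition if no $\alpha\in\kappa$ is $\omega_1$-measurable. *)

theory Defs
  imports "HOL-Analysis.Analysis" "HOL-Algebra.Algebraic_Closure_Type"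
begin

section \<open>Complete valuation fields and Banach spaces\<close>

definition complete_valuation :: "('k::field \<Rightarrow> real) \<Rightarrow> bool" where
  "complete_valuation v \<longleftrightarrow>
     (\<forall>x. 0 \<le> v x) \<and>
     (\<forall>x. v x = 0 \<longleftrightarrow> x = 0) \<and>
     (\<forall>x y. v (x * y) = v x * v y) \<and>
     (\<forall>x y. v (x + y) \<le> max (v x) (v y)) \<and>
     Metric_space.mcomplete UNIV (\<lambda>x y. v (x - y))"

definition valuation_topology :: "('k::field \<Rightarrow> real) \<Rightarrow> 'k topology" where
  "valuation_topology v = Metric_space.mtopology UNIV (\<lambda>x y. v (x - y))"

text \<open>The scalars are the whole type \<open>'k\<close>, viewed as an algebraic structure by
  \<^const>\<open>ring_of_type_algebra\<close>. The fields \<open>mult\<close> and \<open>one\<close> that a \<open>module\<close> record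
  inherits from \<open>ring\<close> carry no information.\<close>

record ('k, 'v) normed_module = "('k, 'v) module" +
  vnorm :: "'v \<Rightarrow> real"

text \<open>The value outside of the carrier only serves to make this an instance of
  \<^locale>\<open>Metric_space\<close>, which constrains the distance on the whole type.\<close>

definition vdist :: "('k, 'v) normed_module \<Rightarrow> 'v \<Rightarrow> 'v \<Rightarrow> real" where
  "vdist V x y =
     (if x \<in> carrier V \<and> y \<in> carrier V then vnorm V (x \<ominus>\<^bsub>V\<^esub> y) else 0)"

definition banach_space :: "('k::field \<Rightarrow> real) \<Rightarrow> ('k, 'v) normed_module \<Rightarrow> bool" where
  "banach_space v V \<longleftrightarrow>
     module ring_of_type_algebra V \<and>
     (\<forall>x\<in>carrier V. 0 \<le> vnorm V x) \<and>
     (\<forall>x\<in>carrier V. vnorm V x = 0 \<longleftrightarrow> x = \<zero>\<^bsub>V\<^esub>) \<and>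
     (\<forall>c. \<forall>x\<in>carrier V. vnorm V (c \<odot>\<^bsub>V\<^esub> x) = v c * vnorm V x) \<and>
     (\<forall>x\<in>carrier V. \<forall>y\<in>carrier V. vnorm V (x \<oplus>\<^bsub>V\<^esub> y) \<le> max (vnorm V x) (vnorm V y)) \<and>
     Metric_space.mcomplete (carrier V) (vdist V)"

definition isometric_iso :: "('k, 'v) normed_module \<Rightarrow> ('k, 'w) normed_module \<Rightarrow> bool"
    (infix \<open>\<cong>\<^sub>B\<close> 50) where
  "V \<cong>\<^sub>B W \<longleftrightarrow>
     (\<exists>f \<in> iso (add_monoid V) (add_monoid W).
        (\<forall>c. \<forall>x\<in>carrier V. f (c \<odot>\<^bsub>V\<^esub> x) = c \<odot>\<^bsub>W\<^esub> f x) \<and>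
        (\<forall>x\<in>carrier V. vnorm W (f x) = vnorm V x))"

section \<open>Constructions\<close>

text \<open>Families indexed by a set \<open>I\<close> are functions on the index type that are
  \<^const>\<open>undefined\<close> outside of \<open>I\<close>. Inserting \<open>0\<close> in a supremum of norms changes
  nothing unless \<open>I\<close> is empty, in which case the only element has norm \<open>0\<close>.\<close>

definition bounded_product ::
    "'i set \<Rightarrow> ('i \<Rightarrow> ('k, 'v) normed_module) \<Rightarrow> ('k, 'i \<Rightarrow> 'v) normed_module" where
  "bounded_product I W =
     \<lparr>carrier = {w \<in> (\<Pi>\<^sub>E i\<in>I. carrier (W i)). bdd_above ((\<lambda>i. vnorm (W i) (w i)) ` I)},
      mult = undefined,
      one = undefined,
      zero = (\<lambda>i\<in>I. \<zero>\<^bsub>W i\<^esub>),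
      add = (\<lambda>w w'. \<lambda>i\<in>I. w i \<oplus>\<^bsub>W i\<^esub> w' i),
      smult = (\<lambda>c w. \<lambda>i\<in>I. c \<odot>\<^bsub>W i\<^esub> w i),
      vnorm = (\<lambda>w. Sup (insert 0 ((\<lambda>i. vnorm (W i) (w i)) ` I)))\<rparr>"

definition completed_sum ::
    "'i set \<Rightarrow> ('i \<Rightarrow> ('k, 'v) normed_module) \<Rightarrow> ('k, 'i \<Rightarrow> 'v) normed_module" where
  "completed_sum I W =
     (bounded_product I W)
       \<lparr>carrier := {w \<in> carrier (bounded_product I W).
          \<forall>\<epsilon>>0. finite {i \<in> I. \<epsilon> \<le> vnorm (W i) (w i)}}\<rparr>"

definition max_norm_space ::
    "('k::field \<Rightarrow> real) \<Rightarrow> nat \<Rightarrow> ('k, nat \<Rightarrow> 'k) normed_module" where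
  "max_norm_space v n =
     \<lparr>carrier = {..<n} \<rightarrow>\<^sub>E UNIV,
      mult = undefined,
      one = undefined,
      zero = (\<lambda>i\<in>{..<n}. 0),
      add = (\<lambda>x y. \<lambda>i\<in>{..<n}. x i + y i),
      smult = (\<lambda>c x. \<lambda>i\<in>{..<n}. c * x i),
      vnorm = (\<lambda>x. Max (insert 0 ((\<lambda>i. v (x i)) ` {..<n})))\<rparr>"

definition bounded_continuous ::
    "('k::field \<Rightarrow> real) \<Rightarrow> 'x topology \<Rightarrow> ('k, 'x \<Rightarrow> 'k) normed_module" where
  "bounded_continuous v T =
     \<lparr>carrier = {f \<in> extensional (topspace T).
        continuous_map T (valuation_topology v) f \<and>
        bdd_above ((\<lambda>x. v (f x)) ` topspace T)},
      mult = undefined,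
      one = undefined,
      zero = (\<lambda>x\<in>topspace T. 0),
      add = (\<lambda>f g. \<lambda>x\<in>topspace T. f x + g x),
      smult = (\<lambda>c f. \<lambda>x\<in>topspace T. c * f x),
      vnorm = (\<lambda>f. Sup (insert 0 ((\<lambda>x. v (f x)) ` topspace T)))\<rparr>"

section \<open>Measurable sets and size bounds\<close>

definition ultrafilter_on :: "'a set \<Rightarrow> 'a set set \<Rightarrow> bool" where
  "ultrafilter_on S U \<longleftrightarrow>
     U \<subseteq> Pow S \<and> S \<in> U \<and> {} \<notin> U \<and>
     (\<forall>A\<in>U. \<forall>B\<in>U. A \<inter> B \<in> U) \<and>
     (\<forall>A\<in>U. \<forall>B. A \<subseteq> B \<and> B \<subseteq> S \<longrightarrow> B \<in> U) \<and>
     (\<forall>A. A \<subseteq> S \<longrightarrow> A \<in> U \<or> S - A \<in> U)"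

definition omega1_measurable :: "'a set \<Rightarrow> bool" where
  "omega1_measurable S \<longleftrightarrow>
     uncountable S \<and>
     (\<exists>U. ultrafilter_on S U \<and>
          \<not> (\<exists>x\<in>S. U = {A. A \<subseteq> S \<and> x \<in> A}) \<and>
          (\<forall>C. countable C \<and> C \<noteq> {} \<and> C \<subseteq> U \<longrightarrow> \<Inter>C \<in> U))"

text \<open>A bound \<open>\<kappa>\<close> on the size of index sets is a cardinal or the class of all
  ordinals. Cardinals are well-order relations as in the HOL cardinals library. The type
  \<open>'i\<close> is at the same time the type of the indices, so that index sets are sets of type
  \<open>'i set\<close>. If \<open>\<kappa>\<close> is a cardinal \<open>r\<close>, this is no restriction since
  every set of cardinality less than \<open>r\<close> is equipotent to a subset of the field of \<open>r\<close>.\<close>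

datatype 'i size_bound = Cardinal "'i rel" | Ord

fun infinite_bound :: "'i size_bound \<Rightarrow> bool" where
  "infinite_bound (Cardinal r) \<longleftrightarrow> Cinfinite r"
| "infinite_bound Ord \<longleftrightarrow> True"

fun size_less :: "'i set \<Rightarrow> 'i size_bound \<Rightarrow> bool" where
  "size_less I (Cardinal r) \<longleftrightarrow> (card_of I, r) \<in> ordLess"
| "size_less I Ord \<longleftrightarrow> True"

text \<open>The elements of a cardinal \<open>r\<close> are its proper initial segments
  \<^term>\<open>underS r a\<close>; the elements of \<^const>\<open>Ord\<close> are the (fields of) well-orders.\<close>

fun nonmeasurability_condition :: "'i size_bound \<Rightarrow> bool" where
  "nonmeasurability_condition (Cardinal r) \<longleftrightarrow>
     (\<forall>a\<in>Field r. \<not> omega1_measurable (underS r a))"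
| "nonmeasurability_condition (Ord :: 'i size_bound) \<longleftrightarrow>
     (\<forall>r :: 'i rel. Well_order r \<longrightarrow> \<not> omega1_measurable (Field r))"

section \<open>The Reid hierarchy\<close>

definition F_class :: "('k::field \<Rightarrow> real) \<Rightarrow> ('k, 'v) normed_module set" where
  "F_class v = {V. banach_space v V \<and> (\<exists>n. V \<cong>\<^sub>B max_norm_space v n)}"

text \<open>\<open>Pi_step\<close> and \<open>Sigma_step\<close> yield \<open>\<Pi>\<^sub>\<alpha>\<close> and \<open>\<Sigma>\<^sub>\<alpha>\<close>
  when \<open>L\<close> is the class \<open>\<R>\<^sub><\<^sub>\<alpha>\<close> of the spaces of lower rank. Since a
  space in \<open>\<Pi>\<^sub>\<alpha>\<close> need only be isomorphic to a product, its elements may be of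
  a different type \<open>'v\<close> than those of the spaces in \<open>L\<close>.\<close>

definition Pi_step :: "('k::field \<Rightarrow> real) \<Rightarrow> 'i size_bound \<Rightarrow>
    ('k, 'u) normed_module set \<Rightarrow> ('k, 'v) normed_module set" where
  "Pi_step v \<kappa> L = F_class v \<union>
     {V. banach_space v V \<and>
         (\<exists>(I :: 'i set) W. size_less I \<kappa> \<and> (\<forall>i\<in>I. W i \<in> L) \<and> V \<cong>\<^sub>B bounded_product I W)}"

definition Sigma_step :: "('k::field \<Rightarrow> real) \<Rightarrow> 'i size_bound \<Rightarrow>
    ('k, 'u) normed_module set \<Rightarrow> ('k, 'v) normed_module set" where
  "Sigma_step v \<kappa> L = F_class v \<union>
     {V. banach_space v V \<and>
         (\<exists>(I :: 'i set) W. size_less I \<kappa> \<and> (\<forall>i\<in>I. W i \<in> L) \<and> V \<cong>\<^sub>B completed_sum I W)}"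

text \<open>The ordinals are the elements of a well-ordered type \<open>'o\<close>, and the
  members of the stages are spaces with elements in a type \<open>'u\<close>. Both types are arbitrary and universally quantified in statements about the hierarchy.\<close>

function reid_stage :: "('k::field \<Rightarrow> real) \<Rightarrow> 'i size_bound \<Rightarrow> 'o::wellorder \<Rightarrow>
    ('k, 'u) normed_module set" where
  "reid_stage v \<kappa> \<alpha> =
     Pi_step v \<kappa> (\<Union>\<beta>\<in>{..<\<alpha>}. reid_stage v \<kappa> \<beta>) \<union>
     Sigma_step v \<kappa> (\<Union>\<beta>\<in>{..<\<alpha>}. reid_stage v \<kappa> \<beta>)"
  by auto
termination
  by (relation "inv_image {(\<alpha>, \<beta>). \<alpha> < \<beta>} (\<lambda>(v, \<kappa>, \<alpha>). \<alpha>)") (auto intro: wf)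

declare reid_stage.simps [simp del]

text \<open>HOL has no type of all sets and no class of all ordinals, so the Reid class is
  relative to a type \<open>'u\<close> holding the constituents of its members and to a type \<open>'o\<close> of
  ordinals. A statement about it covers the absolute notion if it is made for all these types.
  The members themselves may live in any type \<open>'v\<close>; for \<open>'v = 'u\<close> the class is the union of
  the stages, see \<open>reid_class_eq\<close>.\<close>

definition reid_class :: "'u itself \<Rightarrow> 'o::wellorder itself \<Rightarrow> ('k::field \<Rightarrow> real) \<Rightarrow>
    'i size_bound \<Rightarrow> ('k, 'v) normed_module set" where
  "reid_class _ _ v \<kappa> =
     (\<Union>\<alpha>::'o.
        let L = (\<Union>\<beta>\<in>{..<\<alpha>}. reid_stage v \<kappa> \<beta> :: ('k, 'u) normed_module set)
        in Pi_step v \<kappa> L \<union> Sigma_step v \<kappa> L)"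

lemma reid_class_eq:
  "reid_class TYPE('u) TYPE('o::wellorder) v \<kappa> =
     (\<Union>\<alpha>::'o. reid_stage v \<kappa> \<alpha> :: ('k::field, 'u) normed_module set)"
  unfolding reid_class_def Let_def by (intro SUP_cong refl) (rule reid_stage.simps [symmetric])

end

theory Submission
  imports Defs
begin

text \<open>Write \<open>C\<close> for the space of bounded continuous functions on the rationals. Call an operator \<open>T\<close>
  on \<open>C\<close> locally small if, for every \<open>\<epsilon> > 0\<close>, every nonempty open set \<open>D\<close> contains a nonempty
  open set \<open>E\<close> such that \<open>T f\<close> oscillates on \<open>E\<close> by at most \<open>\<epsilon>\<close> times the norm of \<open>f\<close> whenever
  \<open>f\<close> is supported in \<open>E\<close>. The identity is not locally small, since every nonempty open set of rationals
  supports indicator functions. Call a space \<open>V\<close> fragmenting if all compositions of bounded linear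
  maps \<open>C \<rightarrow> V \<rightarrow> C\<close> are locally small. Then \<open>C\<close> is not fragmenting, and it remains to show by
  induction on the rank that all spaces in the Reid class are.

  For the field of scalars this is the continuity of a single function. For maps
  \<open>\<phi> : C \<rightarrow> V\<close> and \<open>\<psi> : V \<rightarrow> C\<close> where \<open>V\<close> is the completed sum or the bounded product of
  fragmenting spaces \<open>W i\<close>, it suffices to find an open set and a finite set \<open>F\<close> of indices such
  that the coordinates outside of \<open>F\<close> contribute little to the oscillation; the finitely many
  compositions through \<open>W i\<close> with \<open>i\<close> in \<open>F\<close> are then treated one after the other
  (\<open>fragmenting_subproduct\<close>).

  The finite set comes from a version of the Chase lemma (\<open>eventually_uniformly_small\<close>): if
  seminorms tend to \<open>0\<close> pointwise on a space in which certain infinite sums with terms of bounded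
  norm exist, then they are eventually small uniformly on deep subspaces. The proof is a gliding
  hump. In the classical setting of abelian groups cancellation between the humps is prevented by
  divisibility; here it is prevented by giving the humps strictly decreasing norms above a positive
  bound, which is possible because \<open>|k|\<close> is dense. The lemma is about
  sequences of seminorms rather than single functionals because, over a spherically complete \<open>k\<close>,
  an infinite product can have nonzero continuous functionals that vanish on all families of finite
  support.

  For a sum, the lemma is applied to the components of \<open>\<phi> f\<close>, where \<open>f\<close> is supported in smaller
  and smaller intervals that shrink to an irrational point, so that infinite sums of such functions
  are still continuous. For a product, it is applied to the variation of \<open>\<psi> w\<close> near a rational
  point, where \<open>w\<close> is supported in sets of indices that decrease to the empty set. It follows that
  the sets of indices that contribute little near this point form an ideal which such sequences
  must enter. If the ideal contained no complement of a finite set, it would give rise to a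
  countably complete nonprincipal ultrafilter (\<open>omega1_measurable_if_null_ideal\<close>), against the
  nonmeasurability condition.\<close>

section \<open>A gliding hump over a densely valued field\<close>

text \<open>A sequence of seminorms \<open>P j\<close> that tends to \<open>0\<close> at every point, on a space with a decreasing
  sequence of subspaces \<open>D n\<close>. The last axiom is the form of completeness that the subspaces
  have: a sequence of terms from deeper and deeper \<open>D (\<nu> m)\<close> can be summed even if the norms do
  not tend to \<open>0\<close>. It gives all tails \<open>r m\<close> at once, since a hump has to be compared with the
  tail that comes after it; the bounds \<open>b m\<close> for these tails decrease with the terms.\<close>

locale diagonal_system =
  fixes v :: "'k \<Rightarrow> real"
    and D :: "nat \<Rightarrow> 'a set"
    and plus :: "'a \<Rightarrow> 'a \<Rightarrow> 'a"
    and scale :: "'k \<Rightarrow> 'a \<Rightarrow> 'a"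
    and N :: "'a \<Rightarrow> real"
    and P :: "nat \<Rightarrow> 'a \<Rightarrow> real"
    and C :: real
  assumes dense: "\<lbrakk>0 < p; p < q\<rbrakk> \<Longrightarrow> \<exists>t. p < v t \<and> v t < q"
    and D_antimono: "m \<le> n \<Longrightarrow> D n \<subseteq> D m"
    and scale_D: "f \<in> D n \<Longrightarrow> scale t f \<in> D n"
    and N_nonneg: "f \<in> D 0 \<Longrightarrow> 0 \<le> N f"
    and N_scale: "f \<in> D 0 \<Longrightarrow> N (scale t f) = v t * N f"
    and P_scale: "f \<in> D 0 \<Longrightarrow> P j (scale t f) = v t * P j f"
    and P_bound: "f \<in> D 0 \<Longrightarrow> P j f \<le> C * N f"
    and P_plus: "\<lbrakk>f \<in> D 0; g \<in> D 0\<rbrakk> \<Longrightarrow> P j f \<le> max (P j (plus f g)) (P j g)"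
    and P_plus': "\<lbrakk>f \<in> D 0; g \<in> D 0\<rbrakk> \<Longrightarrow> P j g \<le> max (P j (plus f g)) (P j f)"
    and P_tendsto: "f \<in> D 0 \<Longrightarrow> (\<lambda>j. P j f) \<longlonglongrightarrow> 0"
    and tail_sums: "\<lbrakk>strict_mono \<nu>; \<And>m. h m \<in> D (\<nu> m); decseq b;
        \<And>m. 0 \<le> b m; \<And>m. N (h m) \<le> b m\<rbrakk>
      \<Longrightarrow> \<exists>r. \<forall>m. r m \<in> D (\<nu> m) \<and> N (r m) \<le> b m \<and> r m = plus (h m) (r (Suc m))"
begin

lemma D_0: "f \<in> D n \<Longrightarrow> f \<in> D 0"
  using D_antimono [of 0 n] by auto

text \<open>Let \<open>c\<close> be the supremum of the \<open>t\<close> such that \<open>t * N f < P j f\<close> has solutions with arbitrarily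
  large \<open>j\<close> and arbitrarily deep \<open>f\<close>. Far out, \<open>P j r\<close> is hardly more than \<open>c * N r\<close>, and
  some \<open>f\<close> almost attains this bound. A multiple of such an \<open>f\<close> with norm between \<open>y\<close> and \<open>x\<close>,
  which exists because the values of \<open>v\<close> are dense, therefore dominates every \<open>r\<close> of norm at
  most \<open>y\<close> at the index \<open>j\<close>, however close \<open>x\<close> is to \<open>y\<close>.\<close>

lemma dominating_element:
  assumes "0 < \<epsilon>" and bad: "\<And>n. \<exists>j\<ge>n. \<exists>f\<in>D n. \<epsilon> * N f < P j f"
  obtains c where "0 < c"
    and "\<And>x y n0. \<lbrakk>1 \<le> y; y < x\<rbrakk> \<Longrightarrow>
      \<exists>n\<ge>n0. \<exists>j\<ge>n. \<exists>f\<in>D n. N f \<le> x \<and> c < P j f \<and> (\<forall>r\<in>D n. N r \<le> y \<longrightarrow> P j r < P j f)"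
proof -
  define Q where "Q t \<longleftrightarrow> (\<forall>n. \<exists>j\<ge>n. \<exists>f\<in>D n. t * N f < P j f)" for t
  have "Q \<epsilon>" using bad by (auto simp: Q_def)
  have Q_less: "t \<le> C" if "Q t" for t
  proof (rule ccontr)
    assume "\<not> t \<le> C"
    obtain j f where f: "f \<in> D 0" "t * N f < P j f" using \<open>Q t\<close> unfolding Q_def by blast
    have "C * N f \<le> t * N f" using N_nonneg [OF f(1)] \<open>\<not> t \<le> C\<close> by (simp add: mult_right_mono)
    then show False using P_bound [OF f(1), of j] f(2) by linarith
  qed
  have bdd: "bdd_above (Collect Q)" using Q_less by (intro bdd_aboveI [of _ C]) simp
  define c where "c = Sup (Collect Q)"
  have "\<epsilon> \<le> c" unfolding c_def using \<open>Q \<epsilon>\<close> bdd by (auto intro: cSup_upper)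
  then have "0 < c" using \<open>0 < \<epsilon>\<close> by linarith
  have Q_below: "Q t" if "t < c" for t
  proof -
    obtain s where s: "Q s" "t < s"
      using \<open>t < c\<close> \<open>Q \<epsilon>\<close> bdd unfolding c_def by (subst (asm) less_cSup_iff) auto
    show ?thesis unfolding Q_def
    proof
      fix n
      obtain j f where "n \<le> j" "f \<in> D n" "s * N f < P j f" using s(1) unfolding Q_def by blast
      moreover have "t * N f \<le> s * N f"
        using s(2) N_nonneg [OF D_0 [OF \<open>f \<in> D n\<close>]] by (simp add: mult_right_mono)
      ultimately show "\<exists>j\<ge>n. \<exists>f\<in>D n. t * N f < P j f"
        by (meson le_less_trans)
    qed
  qed
  have Q_above: "\<not> Q t" if "c < t" for t
    using that bdd cSup_upper [of t "Collect Q"] by (auto simp: c_def)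
  show ?thesis
  proof (rule that [OF \<open>0 < c\<close>])
    fix x y :: real and n0 :: nat
    assume xy: "1 \<le> y" "y < x"
    \<comment> \<open>The margin on each side of \<open>c\<close> is a factor \<open>a\<close>; both together must fit between \<open>y\<close> and \<open>x\<close>.\<close>
    define a where "a = sqrt ((x + y) / (2 * y))"
    have "1 < (x + y) / (2 * y)" using xy by (simp add: field_simps)
    then have "1 < a" by (simp add: a_def)
    have "a * a * y = (x + y) / 2" using xy by (simp add: a_def)
    then have aay: "a * a * y < x" using xy by simp
    have ca: "c < c * a" "c / a < c" using \<open>0 < c\<close> \<open>1 < a\<close> by (auto simp: field_simps)
    obtain n1 where n1: "\<And>j f. \<lbrakk>n1 \<le> j; f \<in> D n1\<rbrakk> \<Longrightarrow> P j f \<le> c * a * N f"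
      using Q_above [OF ca(1)] by (auto simp: Q_def not_less)
    define n where "n = max n0 n1"
    obtain j f where j: "n \<le> j" and f: "f \<in> D n" "c / a * N f < P j f"
      using Q_below [OF ca(2)] unfolding Q_def by blast
    have f0: "f \<in> D 0" using f(1) by (rule D_0)
    have "N f \<noteq> 0" using f(2) P_bound [OF f0, of j] by auto
    then have "0 < N f" using N_nonneg [OF f0] by linarith
    have "0 < a * a * y / N f" using \<open>1 < a\<close> xy \<open>0 < N f\<close> by simp
    moreover have "a * a * y / N f < x / N f" using aay \<open>0 < N f\<close> by (simp add: divide_strict_right_mono)
    ultimately obtain t where t: "a * a * y / N f < v t" "v t < x / N f"
      using dense by blast
    have vt: "0 < v t" using t(1) \<open>0 < a * a * y / N f\<close> by linarith
    let ?g = "scale t f"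
    have Ng: "a * a * y < N ?g" "N ?g < x"
      using t \<open>0 < N f\<close> N_scale [OF f0, of t] by (auto simp: field_simps)
    have "c * a * y = c / a * (a * a * y)" using \<open>1 < a\<close> by simp
    also have "\<dots> < c / a * N ?g" 
      using \<open>0 < c\<close> \<open>1 < a\<close> by (intro mult_strict_left_mono [OF Ng(1)]) simp
    also have "\<dots> = v t * (c / a * N f)" by (simp add: N_scale [OF f0])
    also have "\<dots> < v t * P j f" using f(2) vt by (rule mult_strict_left_mono)
    also have "\<dots> = P j ?g" by (simp add: P_scale [OF f0])
    finally have Pg: "c * a * y < P j ?g" .
    have "c * 1 < c * (a * y)" using \<open>0 < c\<close> \<open>1 < a\<close> xy
      by (intro mult_strict_left_mono) (auto intro: less_1_mult' simp: less_le_trans)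
    then have "c < P j ?g" using Pg by (simp add: mult.assoc)
    moreover have "P j r < P j ?g" if "r \<in> D n" "N r \<le> y" for r
    proof -
      have "P j r \<le> c * a * N r"
        using n1 [of j r] j that(1) D_antimono [of n1 n] by (auto simp: n_def)
      also have "\<dots> \<le> c * a * y" using that(2) \<open>0 < c\<close> \<open>1 < a\<close> by simp
      finally show ?thesis using Pg by linarith
    qed
    ultimately show "\<exists>n\<ge>n0. \<exists>j\<ge>n. \<exists>f\<in>D n. N f \<le> x \<and> c < P j f \<and>
        (\<forall>r\<in>D n. N r \<le> y \<longrightarrow> P j r < P j f)"
      using j scale_D [OF f(1), of t] Ng(2)
      by (intro exI [of _ n] conjI exI [of _ j] bexI [of _ ?g]) (auto simp: n_def)
  qed
qed

text \<open>This is the Chase lemma. If it fails, there are humps \<open>f m\<close> at indices \<open>j m\<close>, each of them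
  dominating everything of slightly smaller norm in its subspace. Giving them norms that
  decrease strictly, but stay above \<open>1\<close>, ensures that no hump is cancelled by the later ones;
  going far enough out in every step ensures that it is not cancelled by the earlier ones. So the
  value of the sum at \<open>j m\<close> is that of the hump, which does not tend to \<open>0\<close>. With constant
  norms the ultrametric inequality would not exclude cancellation, and norms tending to \<open>0\<close> would
  lose the lower bound: strictly decreasing norms with a positive limit are where density enters.\<close>

theorem eventually_uniformly_small:
  assumes "0 < \<epsilon>"
  shows "\<exists>n. \<forall>j\<ge>n. \<forall>f\<in>D n. P j f \<le> \<epsilon> * N f"
proof (rule ccontr)
  assume "\<not> ?thesis"
  then have bad: "\<exists>j\<ge>n. \<exists>f\<in>D n. \<epsilon> * N f < P j f" for n by (meson not_le)
  obtain c where "0 < c" and dom: "\<And>x y n0. \<lbrakk>1 \<le> y; y < x\<rbrakk> \<Longrightarrow>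
      \<exists>n\<ge>n0. \<exists>j\<ge>n. \<exists>f\<in>D n. N f \<le> x \<and> c < P j f \<and> (\<forall>r\<in>D n. N r \<le> y \<longrightarrow> P j r < P j f)"
    by (rule dominating_element [OF assms bad]) blast
  define b where "b m = 1 + 1 / real (Suc m)" for m
  have b_ge: "1 \<le> b m" for m by (simp add: b_def)
  have b_less: "b (Suc m) < b m" for m by (simp add: b_def field_simps)
  have "decseq b" using b_less by (intro decseq_SucI less_imp_le)
  \<comment> \<open>\<open>S m\<close> says that a triple is a hump for stage \<open>m\<close>; \<open>R\<close> that the next hump lies far enough out.\<close>
  define S where "S m s \<longleftrightarrow> (case s of (n, j, f) \<Rightarrow> n \<le> j \<and> f \<in> D n \<and> N f \<le> b m \<and> c < P j f \<and>
      (\<forall>r\<in>D n. N r \<le> b (Suc m) \<longrightarrow> P j r < P j f))" for m :: nat and s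
  define R where "R s s' \<longleftrightarrow> (case (s, s') of ((n, j, f), (n', j', f')) \<Rightarrow>
      n < n' \<and> (\<forall>i\<ge>n'. P i f < c))" for s s' :: "nat \<times> nat \<times> 'a"
  have "\<exists>s. \<forall>m. S m (s m) \<and> R (s m) (s (Suc m))"
  proof (rule dependent_nat_choice)
    show "\<exists>s. S 0 s"
      using dom [OF b_ge b_less, of 0 0] by (auto simp: S_def)
  next
    fix s m assume "S m s"
    obtain n j f where s: "s = (n, j, f)" by (cases s)
    have f0: "f \<in> D 0" using \<open>S m s\<close> D_0 by (auto simp: S_def s)
    obtain k where k: "\<And>i. k \<le> i \<Longrightarrow> P i f < c"
      using order_tendstoD(2) [OF P_tendsto [OF f0] \<open>0 < c\<close>] by (auto simp: eventually_sequentially)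
    obtain n' j' f' where "max k (Suc n) \<le> n'" "n' \<le> j'" "f' \<in> D n'" "N f' \<le> b (Suc m)" "c < P j' f'"
      "\<forall>r\<in>D n'. N r \<le> b (Suc (Suc m)) \<longrightarrow> P j' r < P j' f'"
      using dom [OF b_ge b_less, of "max k (Suc n)" "Suc m"] by blast
    then have "S (Suc m) (n', j', f') \<and> R s (n', j', f')"
      using k by (auto simp: S_def R_def s)
    then show "\<exists>s'. S (Suc m) s' \<and> R s s'" by blast
  qed
  then obtain s where s: "\<And>m. S m (s m)" "\<And>m. R (s m) (s (Suc m))" by blast
  define n j f where "n m = fst (s m)" and "j m = fst (snd (s m))" and "f m = snd (snd (s m))" for m
  have S: "n m \<le> j m" "f m \<in> D (n m)" "N (f m) \<le> b m" "c < P (j m) (f m)"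
    and S_dom: "\<And>r. \<lbrakk>r \<in> D (n m); N r \<le> b (Suc m)\<rbrakk> \<Longrightarrow> P (j m) r < P (j m) (f m)" for m
    using s(1) [of m] by (auto simp: S_def n_def j_def f_def case_prod_beta)
  have n_less: "n m < n (Suc m)" and old_small: "\<And>i. n (Suc m) \<le> i \<Longrightarrow> P i (f m) < c" for m
    using s(2) [of m] by (auto simp: R_def n_def j_def f_def case_prod_beta)
  have n_mono: "strict_mono n" using n_less by (simp add: strict_mono_Suc_iff)
  obtain r where r: "\<And>m. r m \<in> D (n m)" "\<And>m. N (r m) \<le> b m" "\<And>m. r m = plus (f m) (r (Suc m))"
    using tail_sums [OF n_mono S(2) \<open>decseq b\<close> _ S(3)] b_ge by (metis order_trans zero_le_one)
  have r0: "r m \<in> D 0" and f0: "f m \<in> D 0" for m using r(1) S(2) D_0 by blast+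
  \<comment> \<open>At the index \<open>j m\<close> the term \<open>f m\<close> beats both the tail and all earlier terms.\<close>
  have "c < P (j m) (r l)" if "l \<le> m" for l m
    using that
  proof (induction rule: inc_induct)
    case base
    have "r (Suc m) \<in> D (n m)" using r(1) [of "Suc m"] D_antimono [of "n m" "n (Suc m)"] n_less [of m] by auto
    then have "P (j m) (r (Suc m)) < P (j m) (f m)" using S_dom r(2) by blast
    then show ?case using P_plus [where f = "f m" and g = "r (Suc m)" and j = "j m", OF f0 r0, folded r(3)] S(4) [of m] by linarith
  next
    case (step l)
    have "n (Suc l) \<le> n m" using step.hyps n_mono by (simp add: strict_mono_less_eq)
    then have "P (j m) (f l) < c" using old_small S(1) [of m] by auto
    then show ?case using P_plus' [where f = "f l" and g = "r (Suc l)" and j = "j m", OF f0 r0, folded r(3)] step.IH by linarith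
  qed
  then have big: "c < P (j m) (r 0)" for m by blast
  have "\<forall>\<^sub>F i in sequentially. P i (r 0) < c"
    using order_tendstoD(2) [OF P_tendsto [OF r0] \<open>0 < c\<close>] .
  then obtain k where "\<And>i. k \<le> i \<Longrightarrow> P i (r 0) < c" by (auto simp: eventually_sequentially)
  moreover have "k \<le> j k" using S(1) [of k] strict_mono_imp_increasing [OF n_mono, of k] by linarith
  ultimately show False using big [of k] by (meson less_asym)
qed

end

section \<open>Measurable sets from ideals\<close>

lemma omega1_measurableI:
  assumes "ultrafilter_on S U" "\<And>x. x \<in> S \<Longrightarrow> U \<noteq> {A. A \<subseteq> S \<and> x \<in> A}"
    and "\<And>C. \<lbrakk>countable C; C \<noteq> {}; C \<subseteq> U\<rbrakk> \<Longrightarrow> \<Inter>C \<in> U" "uncountable S"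
  shows "omega1_measurable S"
  unfolding omega1_measurable_def using assms by (intro conjI exI [of _ U]) auto

text \<open>Enlarge the given ideal by the finite sets. The hypothesis on decreasing sequences makes the
  result \<open>J\<close> closed under countable unions, because the part of a union that is not covered by
  the first \<open>n\<close> sets decreases to the empty set. It also forbids an infinite sequence of disjoint
  sets outside of \<open>J\<close>, so some set \<open>A\<close> outside of \<open>J\<close> cannot be split into two sets outside of
  \<open>J\<close>. The sets that contain \<open>A\<close> up to a member of \<open>J\<close> then form the ultrafilter; it is not
  principal since \<open>J\<close> contains the singletons.\<close>

lemma omega1_measurable_if_null_ideal:
  fixes null :: "'a set \<Rightarrow> bool"
  assumes mono: "\<And>A B. \<lbrakk>null B; A \<subseteq> B\<rbrakk> \<Longrightarrow> null A"
    and union: "\<And>A B. \<lbrakk>null A; null B\<rbrakk> \<Longrightarrow> null (A \<union> B)"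
    and vanishing: "\<And>B. \<lbrakk>decseq B; B 0 \<subseteq> I; (\<Inter>n. B n) = {}\<rbrakk> \<Longrightarrow> \<exists>n. null (B n)"
    and large: "\<And>F. finite F \<Longrightarrow> \<not> null (I - F)"
  shows "omega1_measurable I"
proof -
  define J where "J A \<longleftrightarrow> (\<exists>F. finite F \<and> null (A - F))" for A
  have null_empty: "null {}" using vanishing [of "\<lambda>_. {}"] by (simp add: decseq_def)
  have J_mono: "J A" if "J B" "A \<subseteq> B" for A B
    using that mono unfolding J_def by (meson Diff_mono order_refl)
  have J_union: "J (A \<union> B)" if "J A" "J B" for A B
  proof -
    obtain F G where "finite F" "null (A - F)" "finite G" "null (B - G)"
      using \<open>J A\<close> \<open>J B\<close> unfolding J_def by blast
    then have "null ((A \<union> B) - (F \<union> G))"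
      by (intro mono [OF union [OF \<open>null (A - F)\<close> \<open>null (B - G)\<close>]]) auto
    then show ?thesis using \<open>finite F\<close> \<open>finite G\<close> by (auto simp: J_def)
  qed
  have J_fin: "J A" if "finite A" for A using that null_empty by (auto simp: J_def)
  have J_vanishing: "\<exists>n. J (B n)" if "decseq B" "B 0 \<subseteq> I" "(\<Inter>n. B n) = {}" for B
    using vanishing [OF that] by (auto simp: J_def intro!: exI [of _ "{}"])
  have J_Union: "J (\<Union>n. A n)" if A: "\<And>n. J (A n)" "\<And>n. A n \<subseteq> I" for A :: "nat \<Rightarrow> 'a set"
  proof -
    define B where "B n = (\<Union>m. A m) - (\<Union>m<n. A m)" for n
    have "decseq B" by (fastforce simp: decseq_def B_def)
    moreover have "B 0 \<subseteq> I" using A(2) by (auto simp: B_def)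
    moreover have "(\<Inter>n. B n) = {}" by (auto simp: B_def)
    ultimately obtain n where "J (B n)" using J_vanishing by blast
    moreover have "J (\<Union>m<n. A m)" for n
      by (induction n) (auto simp: lessThan_Suc J_fin intro: J_union A(1))
    ultimately have "J (B n \<union> (\<Union>m<n. A m))" by (rule J_union)
    then show ?thesis by (rule J_mono) (auto simp: B_def)
  qed
  have "\<not> J I" using large by (auto simp: J_def)
  \<comment> \<open>Otherwise splitting forever would give an infinite sequence of disjoint large sets.\<close>
  have "\<exists>A\<subseteq>I. \<not> J A \<and> (\<forall>B\<subseteq>A. J B \<or> J (A - B))"
  proof (rule ccontr)
    assume no: "\<not> ?thesis"
    have "\<exists>A. \<forall>n::nat. (A n \<subseteq> I \<and> \<not> J (A n)) \<and> (A (Suc n) \<subseteq> A n \<and> \<not> J (A n - A (Suc n)))"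
    proof (rule dependent_nat_choice)
      show "\<exists>A. A \<subseteq> I \<and> \<not> J A" using \<open>\<not> J I\<close> by blast
    next
      fix A n assume "A \<subseteq> I \<and> \<not> J A"
      then obtain B where "B \<subseteq> A" "\<not> J B" "\<not> J (A - B)" using no by meson
      then show "\<exists>B. (B \<subseteq> I \<and> \<not> J B) \<and> B \<subseteq> A \<and> \<not> J (A - B)"
        using \<open>A \<subseteq> I \<and> \<not> J A\<close> by blast
    qed
    then obtain A where A: "\<And>n. A n \<subseteq> I" "\<And>n. A (Suc n) \<subseteq> A n" "\<And>n::nat. \<not> J (A n - A (Suc n))"
      by blast
    define B where "B n = A n - (\<Inter>m. A m)" for n
    have "decseq A" using A(2) by (rule decseq_SucI)
    then have "decseq B" by (auto simp: decseq_def B_def)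
    moreover have "B 0 \<subseteq> I" using A(1) by (auto simp: B_def)
    moreover have "(\<Inter>n. B n) = {}" by (auto simp: B_def)
    ultimately obtain n where "J (B n)" using J_vanishing by blast
    then have "J (A n - A (Suc n))" by (rule J_mono) (auto simp: B_def)
    then show False using A(3) by blast
  qed
  then obtain A where A: "A \<subseteq> I" "\<not> J A" and atom: "\<And>B. B \<subseteq> A \<Longrightarrow> J B \<or> J (A - B)" by blast
  have iff: "J (A \<inter> B) \<longleftrightarrow> \<not> J (A - B)" for B
  proof -
    have "J (A - B) \<or> J (A \<inter> B)" using atom [of "A - B"] by (auto simp: Diff_Diff_Int)
    moreover have "\<not> (J (A - B) \<and> J (A \<inter> B))"
      using J_union [of "A - B" "A \<inter> B"] A(2) by (auto simp: Un_Diff_Int)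
    ultimately show ?thesis by blast
  qed
  define U where "U = {B. B \<subseteq> I \<and> J (A - B)}"
  have "ultrafilter_on I U"
    unfolding ultrafilter_on_def
  proof (intro conjI ballI allI impI)
    show "U \<subseteq> Pow I" by (auto simp: U_def)
    have "J (A - I)" using A(1) by (intro J_fin) (simp add: Diff_eq_empty_iff [THEN iffD2])
    then show "I \<in> U" by (simp add: U_def)
    show "{} \<notin> U" using A(2) by (simp add: U_def)
  next
    fix B C assume "B \<in> U" "C \<in> U"
    then have "J ((A - B) \<union> (A - C))" by (auto simp: U_def intro: J_union)
    then show "B \<inter> C \<in> U" using \<open>B \<in> U\<close> by (auto simp: U_def Diff_Int)
  next
    fix B C assume "B \<in> U" "B \<subseteq> C \<and> C \<subseteq> I"
    then show "C \<in> U" using J_mono [of "A - B" "A - C"] by (auto simp: U_def)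
  next
    fix B assume "B \<subseteq> I"
    have "A - (I - B) = A \<inter> B" using A(1) by blast
    then show "B \<in> U \<or> I - B \<in> U" using iff [of B] \<open>B \<subseteq> I\<close> by (auto simp: U_def)
  qed
  moreover have "U \<noteq> {B. B \<subseteq> I \<and> x \<in> B}" if "x \<in> I" for x
  proof
    assume "U = {B. B \<subseteq> I \<and> x \<in> B}"
    then have "{x} \<in> U" using that by auto
    then have "J (A - {x})" by (simp add: U_def)
    moreover have "J (A \<inter> {x})" by (simp add: J_fin)
    ultimately show False using iff by blast
  qed
  moreover have "\<Inter>C \<in> U" if C: "countable C" "C \<noteq> {}" "C \<subseteq> U" for C
  proof -
    have ran: "range (from_nat_into C) = C" using C by (simp add: range_from_nat_into)
    then have mem: "from_nat_into C n \<in> U" for n using C(3) by blast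
    have "J (\<Union>n. A - from_nat_into C n)"
      using mem A(1) by (intro J_Union) (auto simp: U_def)
    also have "(\<Union>n. A - from_nat_into C n) = A - \<Inter>C" by (subst (2) ran [symmetric]) auto
    finally show ?thesis using C(2,3) by (auto simp: U_def)
  qed
  moreover have "uncountable I"
  proof
    assume "countable I"
    have "I \<noteq> {}" using \<open>\<not> J I\<close> J_fin by blast
    then have ran: "range (from_nat_into I) = I" using \<open>countable I\<close> by (simp add: range_from_nat_into)
    have "J (\<Union>n. {from_nat_into I n})"
      using ran by (intro J_Union J_fin) auto
    moreover have "(\<Union>n. {from_nat_into I n}) = I" using ran by auto
    ultimately show False using \<open>\<not> J I\<close> by simp
  qed
  ultimately show ?thesis by (rule omega1_measurableI)
qed

lemma omega1_measurable_bij_betw: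
  assumes f: "bij_betw f S T" and "omega1_measurable S"
  shows "omega1_measurable T"
proof -
  obtain U where "uncountable S" and U: "ultrafilter_on S U"
    and nonpr: "\<not> (\<exists>x\<in>S. U = {A. A \<subseteq> S \<and> x \<in> A})"
    and cplt: "\<forall>C. countable C \<and> C \<noteq> {} \<and> C \<subseteq> U \<longrightarrow> \<Inter>C \<in> U"
    using assms(2) unfolding omega1_measurable_def by (elim conjE exE) (rule that)
  have inj: "inj_on f S" and T: "T = f ` S" using f by (auto simp: bij_betw_def)
  define h where "h B = f -` B \<inter> S" for B
  define U' where "U' = {B. B \<subseteq> T \<and> h B \<in> U}"
  have "ultrafilter_on T U'"
    unfolding ultrafilter_on_def
  proof (intro conjI ballI allI impI)
    show "U' \<subseteq> Pow T" by (auto simp: U'_def)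
    have "h T = S" by (auto simp: h_def T)
    then show "T \<in> U'" using U by (simp add: U'_def ultrafilter_on_def)
    show "{} \<notin> U'" using U by (simp add: U'_def h_def ultrafilter_on_def)
  next
    fix B C assume "B \<in> U'" "C \<in> U'"
    moreover have "h (B \<inter> C) = h B \<inter> h C" by (auto simp: h_def)
    ultimately show "B \<inter> C \<in> U'" using U by (auto simp: U'_def ultrafilter_on_def)
  next
    fix B C assume "B \<in> U'" "B \<subseteq> C \<and> C \<subseteq> T"
    moreover from this have "h B \<subseteq> h C \<and> h C \<subseteq> S" by (auto simp: h_def)
    moreover have "\<forall>A\<in>U. \<forall>B. A \<subseteq> B \<and> B \<subseteq> S \<longrightarrow> B \<in> U" using U by (simp add: ultrafilter_on_def)
    ultimately show "C \<in> U'" unfolding U'_def by blast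
  next
    fix B assume "B \<subseteq> T"
    have "h (T - B) = S - h B" "h B \<subseteq> S" by (auto simp: h_def T)
    then show "B \<in> U' \<or> T - B \<in> U'" using U \<open>B \<subseteq> T\<close> by (auto simp: U'_def ultrafilter_on_def)
  qed
  moreover have "U' \<noteq> {B. B \<subseteq> T \<and> y \<in> B}" if "y \<in> T" for y
  proof
    assume eq: "U' = {B. B \<subseteq> T \<and> y \<in> B}"
    obtain x where x: "x \<in> S" "y = f x" using \<open>y \<in> T\<close> T by blast
    have hf: "h (f ` A) = A" if "A \<subseteq> S" for A using that inj by (auto simp: h_def dest: inj_onD)
    have "A \<in> U \<longleftrightarrow> A \<subseteq> S \<and> x \<in> A" for A
    proof (cases "A \<subseteq> S")
      case True
      have "A \<in> U \<longleftrightarrow> f ` A \<in> U'" using True T by (simp add: U'_def hf image_mono)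
      also have "\<dots> \<longleftrightarrow> x \<in> A" using eq True T x inj by (auto dest: inj_onD)
      finally show ?thesis using True by simp
    next
      case False
      then show ?thesis using U by (auto simp: ultrafilter_on_def)
    qed
    then show False using nonpr x(1) by blast
  qed
  moreover have "\<Inter>C \<in> U'" if C: "countable C" "C \<noteq> {}" "C \<subseteq> U'" for C
  proof -
    have "\<Inter>(h ` C) \<in> U" using C by (intro cplt [rule_format] conjI) (auto simp: U'_def)
    moreover have "\<Inter>(h ` C) = h (\<Inter>C)" using C(2) by (auto simp: h_def)
    moreover have "\<Inter>C \<subseteq> T" using C(2,3) by (fastforce simp: U'_def)
    ultimately show ?thesis by (simp add: U'_def)
  qed
  moreover have "uncountable T"
    using \<open>uncountable S\<close> countable_image_inj_on [OF _ inj] T by auto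
  ultimately show ?thesis by (rule omega1_measurableI)
qed

text \<open>A set of cardinality less than \<open>r\<close> is equipotent to a proper initial segment of \<open>r\<close>, and
  measurability depends on the cardinality only.\<close>

lemma not_omega1_measurable_if_size_less:
  fixes I :: "'i set"
  assumes "infinite_bound \<kappa>" "nonmeasurability_condition \<kappa>" "size_less I \<kappa>"
  shows "\<not> omega1_measurable I"
proof (cases \<kappa>)
  case (Cardinal r)
  then have "Well_order r" and less: "(card_of I, r) \<in> ordLess"
    using assms by (auto simp: card_order_on_well_order_on)
  then obtain a where a: "a \<in> Field r" "(card_of I, Restr r (underS r a)) \<in> ordIso"
    using ordLess_iff_ordIso_Restr [of r "card_of I"] card_of_Well_order by blast
  then obtain f where "bij_betw f (Field (card_of I)) (Field (Restr r (underS r a)))"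
    unfolding ordIso_def BNF_Wellorder_Embedding.iso_def by blast
  moreover have "Field (Restr r (underS r a)) = underS r a"
    using \<open>Well_order r\<close> by (simp add: Field_Restr_ofilter wo_rel.underS_ofilter wo_rel_def)
  ultimately have "bij_betw f I (underS r a)" by (simp add: Field_card_of)
  then show ?thesis using omega1_measurable_bij_betw assms(2) Cardinal a(1) by auto
next
  case Ord
  then have "\<not> omega1_measurable (Field (card_of I))"
    using assms(2) card_of_Well_order [of I] by simp
  then show ?thesis by (simp add: Field_card_of)
qed

section \<open>Ultrametric normed modules and their products\<close>

text \<open>The algebraic and norm axioms of \<^const>\<open>banach_space\<close>, which the estimates for families
  use one coordinate at a time.\<close>

definition ultranormed :: "('k::field \<Rightarrow> real) \<Rightarrow> ('k, 'v) normed_module \<Rightarrow> bool" where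
  "ultranormed v V \<longleftrightarrow>
     module ring_of_type_algebra V \<and>
     (\<forall>x\<in>carrier V. 0 \<le> vnorm V x) \<and>
     (\<forall>x\<in>carrier V. vnorm V x = 0 \<longleftrightarrow> x = \<zero>\<^bsub>V\<^esub>) \<and>
     (\<forall>c. \<forall>x\<in>carrier V. vnorm V (c \<odot>\<^bsub>V\<^esub> x) = v c * vnorm V x) \<and>
     (\<forall>x\<in>carrier V. \<forall>y\<in>carrier V. vnorm V (x \<oplus>\<^bsub>V\<^esub> y) \<le> max (vnorm V x) (vnorm V y))"

lemma ultranormed_if_banach_space: "banach_space v V \<Longrightarrow> ultranormed v V"
  by (simp add: banach_space_def ultranormed_def)

definition bounded_linear_map ::
    "('k, 'v) normed_module \<Rightarrow> ('k, 'w) normed_module \<Rightarrow> ('v \<Rightarrow> 'w) \<Rightarrow> bool" where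
  "bounded_linear_map V W T \<longleftrightarrow>
     (\<forall>x\<in>carrier V. T x \<in> carrier W) \<and>
     (\<forall>x\<in>carrier V. \<forall>y\<in>carrier V. T (x \<oplus>\<^bsub>V\<^esub> y) = T x \<oplus>\<^bsub>W\<^esub> T y) \<and>
     (\<forall>c. \<forall>x\<in>carrier V. T (c \<odot>\<^bsub>V\<^esub> x) = c \<odot>\<^bsub>W\<^esub> T x) \<and>
     (\<exists>C>0. \<forall>x\<in>carrier V. vnorm W (T x) \<le> C * vnorm V x)"

lemma bounded_linear_map_comp:
  assumes S: "bounded_linear_map U V S" and T: "bounded_linear_map V W T"
  shows "bounded_linear_map U W (T \<circ> S)"
proof -
  obtain C C' where C: "0 < C" "\<And>x. x \<in> carrier U \<Longrightarrow> vnorm V (S x) \<le> C * vnorm U x"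
    and C': "0 < C'" "\<And>x. x \<in> carrier V \<Longrightarrow> vnorm W (T x) \<le> C' * vnorm V x"
    using S T unfolding bounded_linear_map_def by metis
  have "vnorm W (T (S x)) \<le> (C' * C) * vnorm U x" if "x \<in> carrier U" for x
  proof -
    have "vnorm W (T (S x)) \<le> C' * vnorm V (S x)"
      using C'(2) S that by (auto simp: bounded_linear_map_def)
    also have "\<dots> \<le> C' * (C * vnorm U x)" using C(2) [OF that] C'(1) by simp
    finally show ?thesis by (simp add: mult.assoc)
  qed
  moreover have "0 < C' * C" using C(1) C'(1) by simp
  ultimately have "\<exists>C>0. \<forall>x\<in>carrier U. vnorm W ((T \<circ> S) x) \<le> C * vnorm U x" by auto
  then show ?thesis
    using S T unfolding bounded_linear_map_def by auto
qed

text \<open>Bounded products and completed sums have the same operations and norm and differ in the carrier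
  only, so most arguments apply to both.\<close>

definition subproduct ::
    "'i set \<Rightarrow> ('i \<Rightarrow> ('k, 'v) normed_module) \<Rightarrow> ('i \<Rightarrow> 'v) set \<Rightarrow> ('k, 'i \<Rightarrow> 'v) normed_module" where
  "subproduct I W S = (bounded_product I W)\<lparr>carrier := S\<rparr>"

lemma subproduct_simps [simp]:
  "carrier (subproduct I W S) = S"
  "w \<oplus>\<^bsub>subproduct I W S\<^esub> w' = w \<oplus>\<^bsub>bounded_product I W\<^esub> w'"
  "c \<odot>\<^bsub>subproduct I W S\<^esub> w = c \<odot>\<^bsub>bounded_product I W\<^esub> w"
  "vnorm (subproduct I W S) w = vnorm (bounded_product I W) w"
  by (simp_all add: subproduct_def)

lemma bounded_product_add: "w \<oplus>\<^bsub>bounded_product I W\<^esub> w' = (\<lambda>i\<in>I. w i \<oplus>\<^bsub>W i\<^esub> w' i)"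
  and bounded_product_smult: "c \<odot>\<^bsub>bounded_product I W\<^esub> w = (\<lambda>i\<in>I. c \<odot>\<^bsub>W i\<^esub> w i)"
  by (simp_all add: bounded_product_def)

lemma bounded_product_eq_subproduct:
  "bounded_product I W = subproduct I W (carrier (bounded_product I W))"
  by (simp add: subproduct_def)

lemma completed_sum_eq_subproduct:
  "completed_sum I W = subproduct I W (carrier (completed_sum I W))"
  by (simp add: subproduct_def completed_sum_def)

lemma component_closed:
  "\<lbrakk>w \<in> carrier (bounded_product I W); i \<in> I\<rbrakk> \<Longrightarrow> w i \<in> carrier (W i)"
  by (auto simp: bounded_product_def)

lemma component_le_norm:
  assumes "w \<in> carrier (bounded_product I W)" "i \<in> I"
  shows "vnorm (W i) (w i) \<le> vnorm (bounded_product I W) w"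
  using assms by (auto simp: bounded_product_def intro!: cSup_upper)

lemma norm_bounded_product_nonneg:
  assumes "w \<in> carrier (bounded_product I W)"
  shows "0 \<le> vnorm (bounded_product I W) w"
  using assms by (auto simp: bounded_product_def intro!: cSup_upper)

lemma norm_bounded_product_le:
  assumes "0 \<le> b" "\<And>i. i \<in> I \<Longrightarrow> vnorm (W i) (w i) \<le> b"
  shows "vnorm (bounded_product I W) w \<le> b"
  using assms by (auto simp: bounded_product_def intro!: cSup_least)

lemma bounded_productI:
  assumes "w \<in> extensional I" "\<And>i. i \<in> I \<Longrightarrow> w i \<in> carrier (W i)"
    "\<And>i. i \<in> I \<Longrightarrow> vnorm (W i) (w i) \<le> b"
  shows "w \<in> carrier (bounded_product I W)"
  using assms by (auto simp: bounded_product_def PiE_def intro!: bdd_aboveI [of _ b])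

definition vanishes_off :: "'i set \<Rightarrow> ('i \<Rightarrow> ('k, 'v) normed_module) \<Rightarrow> 'i set \<Rightarrow> ('i \<Rightarrow> 'v) \<Rightarrow> bool" where
  "vanishes_off I W A w \<longleftrightarrow> (\<forall>i\<in>I - A. w i = \<zero>\<^bsub>W i\<^esub>)"

definition cutoff :: "'i set \<Rightarrow> ('i \<Rightarrow> ('k, 'v) normed_module) \<Rightarrow> 'i set \<Rightarrow> ('i \<Rightarrow> 'v) \<Rightarrow> 'i \<Rightarrow> 'v" where
  "cutoff I W A w = (\<lambda>i\<in>I. if i \<in> A then w i else \<zero>\<^bsub>W i\<^esub>)"

definition single :: "'i set \<Rightarrow> ('i \<Rightarrow> ('k, 'v) normed_module) \<Rightarrow> 'i \<Rightarrow> 'v \<Rightarrow> 'i \<Rightarrow> 'v" where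
  "single I W i x = (\<lambda>j\<in>I. if j = i then x else \<zero>\<^bsub>W j\<^esub>)"

lemma cutoff_singleton: "cutoff I W {i} w = single I W i (w i)"
  by (auto simp: cutoff_def single_def fun_eq_iff)

lemma cutoff_id:
  assumes w: "w \<in> carrier (bounded_product I W)" and "vanishes_off I W A w"
  shows "cutoff I W A w = w"
  using assms by (fastforce simp: bounded_product_def cutoff_def vanishes_off_def fun_eq_iff PiE_def
      extensional_def)

lemma carrier_completed_sum:
  "carrier (completed_sum I W) = {w \<in> carrier (bounded_product I W).
     \<forall>\<epsilon>>0. finite {i \<in> I. \<epsilon> \<le> vnorm (W i) (w i)}}"
  by (simp add: completed_sum_def)

locale dense_valuation =
  fixes v :: "'k::field \<Rightarrow> real"
  assumes v_nonneg [simp]: "0 \<le> v x"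
    and v_eq_0_iff [simp]: "v x = 0 \<longleftrightarrow> x = 0"
    and v_mult: "v (x * y) = v x * v y"
    and v_add: "v (x + y) \<le> max (v x) (v y)"
    and v_dense: "\<lbrakk>0 < p; p < q\<rbrakk> \<Longrightarrow> \<exists>t. p < v t \<and> v t < q"
begin

lemma v_0 [simp]: "v 0 = 0"
  by simp

lemma v_1 [simp]: "v 1 = 1"
  using v_mult [of 1 1] v_eq_0_iff [of 1] by simp

lemma v_minus_1: "v (- 1) = 1"
proof -
  have "v (- 1) * v (- 1) = 1" using v_mult [of "- 1" "- 1"] by simp
  then have "(v (- 1))\<^sup>2 = 1" by (simp add: power2_eq_square)
  then show ?thesis using v_nonneg [of "- 1"] by (auto simp: power2_eq_1_iff)
qed

lemma v_minus [simp]: "v (- x) = v x"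
  using v_mult [of "- 1" x] by (simp add: v_minus_1)

lemma v_diff_commute: "v (x - y) = v (y - x)"
  using v_minus [of "x - y"] by simp

lemma v_diff_triangle: "v (x - z) \<le> max (v (x - y)) (v (y - z))"
  using v_add [of "x - y" "y - z"] by simp

context
  fixes V :: "('k, 'v) normed_module"
  assumes V: "ultranormed v V"
begin

interpretation V: module ring_of_type_algebra V
  using V by (simp add: ultranormed_def)

lemma zero_closed: "\<zero>\<^bsub>V\<^esub> \<in> carrier V"
  by simp

lemma add_closed: "\<lbrakk>x \<in> carrier V; y \<in> carrier V\<rbrakk> \<Longrightarrow> x \<oplus>\<^bsub>V\<^esub> y \<in> carrier V"
  by simp

lemma smult_closed: "x \<in> carrier V \<Longrightarrow> c \<odot>\<^bsub>V\<^esub> x \<in> carrier V"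
  using V.smult_closed [of c x] by (simp add: ring_of_type_algebra_def)

lemma add_zero: "x \<in> carrier V \<Longrightarrow> x \<oplus>\<^bsub>V\<^esub> \<zero>\<^bsub>V\<^esub> = x"
  and zero_add: "x \<in> carrier V \<Longrightarrow> \<zero>\<^bsub>V\<^esub> \<oplus>\<^bsub>V\<^esub> x = x"
  by simp_all

lemma smult_zero: "c \<odot>\<^bsub>V\<^esub> \<zero>\<^bsub>V\<^esub> = \<zero>\<^bsub>V\<^esub>"
  using V.smult_r_null [of c] by (simp add: ring_of_type_algebra_def)

lemma norm_nonneg: "x \<in> carrier V \<Longrightarrow> 0 \<le> vnorm V x"
  and norm_smult: "x \<in> carrier V \<Longrightarrow> vnorm V (c \<odot>\<^bsub>V\<^esub> x) = v c * vnorm V x"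
  and norm_add: "\<lbrakk>x \<in> carrier V; y \<in> carrier V\<rbrakk>
    \<Longrightarrow> vnorm V (x \<oplus>\<^bsub>V\<^esub> y) \<le> max (vnorm V x) (vnorm V y)"
  and norm_zero: "vnorm V \<zero>\<^bsub>V\<^esub> = 0"
  using V by (auto simp: ultranormed_def)

lemma norm_le_max_add:
  assumes x: "x \<in> carrier V" and y: "y \<in> carrier V"
  shows "vnorm V x \<le> max (vnorm V (x \<oplus>\<^bsub>V\<^esub> y)) (vnorm V y)"
proof -
  let ?y' = "(- 1) \<odot>\<^bsub>V\<^esub> y"
  have y': "?y' \<in> carrier V" using y by (rule smult_closed)
  have "y \<oplus>\<^bsub>V\<^esub> ?y' = (1 + - 1) \<odot>\<^bsub>V\<^esub> y"
    using V.smult_l_distr [of 1 "- 1" y] V.smult_one [of y] y by (simp add: ring_of_type_algebra_def)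
  also have "\<dots> = \<zero>\<^bsub>V\<^esub>" using V.smult_l_null [of y] y by (simp add: ring_of_type_algebra_def)
  finally have "x = (x \<oplus>\<^bsub>V\<^esub> y) \<oplus>\<^bsub>V\<^esub> ?y'" using x y y' by (simp add: V.a_assoc)
  then have "vnorm V x \<le> max (vnorm V (x \<oplus>\<^bsub>V\<^esub> y)) (vnorm V ?y')"
    using norm_add [of "x \<oplus>\<^bsub>V\<^esub> y" ?y'] x y y' by simp
  then show ?thesis using norm_smult [OF y, of "- 1"] by (simp add: v_minus_1)
qed

lemma norm_le_max_add':
  assumes x: "x \<in> carrier V" and y: "y \<in> carrier V"
  shows "vnorm V y \<le> max (vnorm V (x \<oplus>\<^bsub>V\<^esub> y)) (vnorm V x)"
  using norm_le_max_add [OF y x] x y by (simp add: V.a_comm)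

end

context
  fixes I :: "'i set" and W :: "'i \<Rightarrow> ('k, 'v) normed_module"
  assumes W: "\<And>i. i \<in> I \<Longrightarrow> ultranormed v (W i)"
begin

lemma smult_bounded_product_closed:
  assumes "w \<in> carrier (bounded_product I W)"
  shows "c \<odot>\<^bsub>bounded_product I W\<^esub> w \<in> carrier (bounded_product I W)"
proof (rule bounded_productI)
  fix i assume "i \<in> I"
  then show "(c \<odot>\<^bsub>bounded_product I W\<^esub> w) i \<in> carrier (W i)"
    using assms component_closed by (auto simp: bounded_product_smult intro!: smult_closed W)
  show "vnorm (W i) ((c \<odot>\<^bsub>bounded_product I W\<^esub> w) i) \<le> v c * vnorm (bounded_product I W) w"
    using \<open>i \<in> I\<close> component_le_norm [OF assms \<open>i \<in> I\<close>]
    by (auto simp: bounded_product_smult norm_smult [OF W component_closed [OF assms]]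
        intro!: mult_left_mono)
qed (simp add: bounded_product_smult)

lemma norm_smult_bounded_product:
  assumes w: "w \<in> carrier (bounded_product I W)"
  shows "vnorm (bounded_product I W) (c \<odot>\<^bsub>bounded_product I W\<^esub> w) =
    v c * vnorm (bounded_product I W) w"
proof (rule antisym)
  have norm_i: "vnorm (W i) ((c \<odot>\<^bsub>bounded_product I W\<^esub> w) i) = v c * vnorm (W i) (w i)"
    if "i \<in> I" for i
    using that component_closed [OF w] by (auto simp: bounded_product_smult norm_smult W)
  show "vnorm (bounded_product I W) (c \<odot>\<^bsub>bounded_product I W\<^esub> w) \<le> v c * vnorm (bounded_product I W) w"
    using component_le_norm [OF w] norm_bounded_product_nonneg [OF w]
    by (intro norm_bounded_product_le) (auto simp: norm_i intro!: mult_left_mono)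
  have cw: "c \<odot>\<^bsub>bounded_product I W\<^esub> w \<in> carrier (bounded_product I W)"
    using w by (rule smult_bounded_product_closed)
  show "v c * vnorm (bounded_product I W) w \<le> vnorm (bounded_product I W) (c \<odot>\<^bsub>bounded_product I W\<^esub> w)"
  proof (cases "c = 0")
    case True
    then show ?thesis using norm_bounded_product_nonneg [OF cw] by simp
  next
    case False
    then have "0 < v c" using v_nonneg [of c] v_eq_0_iff [of c] by linarith
    then have "vnorm (bounded_product I W) w \<le>
        vnorm (bounded_product I W) (c \<odot>\<^bsub>bounded_product I W\<^esub> w) / v c"
      using component_le_norm [OF cw] norm_bounded_product_nonneg [OF cw]
      by (intro norm_bounded_product_le) (auto simp: norm_i field_simps)
    then show ?thesis using \<open>0 < v c\<close> by (simp add: field_simps)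
  qed
qed

lemma norm_cutoff_le:
  assumes w: "w \<in> carrier (bounded_product I W)"
    and "0 \<le> b" "\<And>i. i \<in> A \<inter> I \<Longrightarrow> vnorm (W i) (w i) \<le> b"
  shows "vnorm (bounded_product I W) (cutoff I W A w) \<le> b"
  using assms by (intro norm_bounded_product_le) (auto simp: cutoff_def norm_zero W)

lemma cutoff_closed:
  assumes w: "w \<in> carrier (bounded_product I W)"
  shows "cutoff I W A w \<in> carrier (bounded_product I W)"
  using component_closed [OF w] component_le_norm [OF w] norm_bounded_product_nonneg [OF w]
  by (intro bounded_productI [where b = "vnorm (bounded_product I W) w"])
    (auto simp: cutoff_def norm_zero zero_closed W)

lemma single_closed:
  assumes "x \<in> carrier (W i)" "i \<in> I"
  shows "single I W i x \<in> carrier (bounded_product I W)"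
  using assms by (intro bounded_productI [where b = "vnorm (W i) x"])
    (auto simp: single_def norm_zero zero_closed norm_nonneg W)

lemma cutoff_split:
  assumes w: "w \<in> carrier (bounded_product I W)" and "A \<inter> B = {}"
  shows "cutoff I W (A \<union> B) w = cutoff I W A w \<oplus>\<^bsub>bounded_product I W\<^esub> cutoff I W B w"
  using assms component_closed [OF w] W
  by (auto simp: bounded_product_add cutoff_def fun_eq_iff add_zero zero_add zero_closed)

text \<open>Since the sets \<open>B n\<close> leave every index eventually, the sums
  \<open>r m = f m + f (m + 1) + \<dots>\<close> are finite at each index.\<close>

lemma tail_sums_bounded_product:
  assumes B: "decseq B" "(\<Inter>n. B n) = {}" and n: "strict_mono n"
    and f: "\<And>m. f m \<in> carrier (bounded_product I W)" "\<And>m. vanishes_off I W (B (n m)) (f m)"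
    and b: "decseq b" "\<And>m. 0 \<le> b m" "\<And>m. vnorm (bounded_product I W) (f m) \<le> b m"
  shows "\<exists>r. \<forall>m. r m \<in> carrier (bounded_product I W) \<and> vanishes_off I W (B (n m)) (r m) \<and>
    vnorm (bounded_product I W) (r m) \<le> b m \<and> r m = f m \<oplus>\<^bsub>bounded_product I W\<^esub> r (Suc m)"
proof -
  have "\<exists>k. i \<notin> B k" for i using B(2) by blast
  then obtain k where k: "\<And>i. i \<notin> B (k i)" by metis
  have f_zero: "f l i = \<zero>\<^bsub>W i\<^esub>" if "i \<in> I" "i \<notin> B (n m)" "m \<le> l" for i l m
  proof -
    have "n m \<le> n l" using n \<open>m \<le> l\<close> by (simp add: strict_mono_less_eq)
    then have "B (n l) \<subseteq> B (n m)" using B(1) by (simp add: decseq_def)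
    then show ?thesis using f(2) [of l] that by (auto simp: vanishes_off_def)
  qed
  have f_late: "f l i = \<zero>\<^bsub>W i\<^esub>" if "i \<in> I" "k i \<le> l" for i l
  proof -
    have "k i \<le> n l" using that(2) strict_mono_imp_increasing [OF n, of l] by linarith
    then have "B (n l) \<subseteq> B (k i)" using B(1) by (simp add: decseq_def)
    then show ?thesis using f(2) [of l] that k [of i] by (auto simp: vanishes_off_def)
  qed
  define s where "s i ls = foldr (\<lambda>l a. f l i \<oplus>\<^bsub>W i\<^esub> a) ls \<zero>\<^bsub>W i\<^esub>" for i ls
  have s_bound: "s i ls \<in> carrier (W i) \<and> vnorm (W i) (s i ls) \<le> b m"
    if "i \<in> I" "\<forall>l\<in>set ls. m \<le> l" for i ls m
    using that(2)
  proof (induction ls)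
    case Nil
    then show ?case using W [OF \<open>i \<in> I\<close>] b(2) by (simp add: s_def zero_closed norm_zero)
  next
    case (Cons l ls)
    have fl: "f l i \<in> carrier (W i)" using f(1) \<open>i \<in> I\<close> by (rule component_closed)
    have "vnorm (W i) (f l i) \<le> b l"
      using component_le_norm [OF f(1) \<open>i \<in> I\<close>] b(3) order_trans by blast
    also have "\<dots> \<le> b m" using b(1) Cons.prems by (simp add: decseq_def)
    finally have "vnorm (W i) (f l i) \<le> b m" .
    moreover have "s i (l # ls) = f l i \<oplus>\<^bsub>W i\<^esub> s i ls" by (simp add: s_def)
    ultimately show ?case
      using Cons norm_add [OF W [OF \<open>i \<in> I\<close>] fl, of "s i ls"] add_closed [OF W [OF \<open>i \<in> I\<close>] fl]
      by fastforce
  qed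
  have s_zero: "s i ls = \<zero>\<^bsub>W i\<^esub>" if "i \<in> I" "i \<notin> B (n m)" "\<forall>l\<in>set ls. m \<le> l" for i ls m
    using that(3)
    by (induction ls) (use that f_zero in \<open>auto simp: s_def zero_add zero_closed W\<close>)
  define r where "r m = (\<lambda>i\<in>I. s i [m..<k i])" for m
  have "r m \<in> carrier (bounded_product I W)" for m
    using s_bound by (intro bounded_productI [where b = "b m"]) (auto simp: r_def)
  moreover have "vanishes_off I W (B (n m)) (r m)" for m
    using s_zero by (auto simp: vanishes_off_def r_def)
  moreover have "vnorm (bounded_product I W) (r m) \<le> b m" for m
    using s_bound b(2) by (intro norm_bounded_product_le) (auto simp: r_def)
  moreover have "r m = f m \<oplus>\<^bsub>bounded_product I W\<^esub> r (Suc m)" for m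
  proof -
    have "s i [m..<k i] = f m i \<oplus>\<^bsub>W i\<^esub> s i [Suc m..<k i]" if "i \<in> I" for i
    proof (cases "m < k i")
      case True
      then show ?thesis by (simp add: s_def upt_conv_Cons)
    next
      case False
      then show ?thesis using f_late that by (simp add: s_def zero_add zero_closed W)
    qed
    then show ?thesis by (auto simp: r_def bounded_product_add fun_eq_iff)
  qed
  ultimately show ?thesis by blast
qed

text \<open>The Chase lemma for families whose support lies in sets of indices that decrease to the empty
  set. It is needed for the full product as well as for the continuous functions on the rationals,
  where only those tail sums count that are again continuous.\<close>

theorem chase_subproduct:
  fixes P :: "nat \<Rightarrow> ('i \<Rightarrow> 'v) \<Rightarrow> real"
  assumes B: "decseq B" "(\<Inter>n. B n) = {}"
    and S: "S \<subseteq> carrier (bounded_product I W)"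
    and smult_S: "\<And>c w. w \<in> S \<Longrightarrow> c \<odot>\<^bsub>bounded_product I W\<^esub> w \<in> S"
    and tails_S: "\<And>n f r m. \<lbrakk>strict_mono n; \<And>m. f m \<in> S; \<And>m. r m \<in> carrier (bounded_product I W);
      \<And>m. vanishes_off I W (B (n m)) (r m);
      \<And>m. r m = f m \<oplus>\<^bsub>bounded_product I W\<^esub> r (Suc m)\<rbrakk> \<Longrightarrow> r m \<in> S"
    and P_smult: "\<And>j c w. w \<in> S \<Longrightarrow> P j (c \<odot>\<^bsub>bounded_product I W\<^esub> w) = v c * P j w"
    and P_bound: "\<And>j w. w \<in> S \<Longrightarrow> P j w \<le> C * vnorm (bounded_product I W) w"
    and P_add: "\<And>j w w'. \<lbrakk>w \<in> S; w' \<in> S\<rbrakk>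
      \<Longrightarrow> P j w \<le> max (P j (w \<oplus>\<^bsub>bounded_product I W\<^esub> w')) (P j w')"
    and P_add': "\<And>j w w'. \<lbrakk>w \<in> S; w' \<in> S\<rbrakk>
      \<Longrightarrow> P j w' \<le> max (P j (w \<oplus>\<^bsub>bounded_product I W\<^esub> w')) (P j w)"
    and P_tendsto: "\<And>w. w \<in> S \<Longrightarrow> (\<lambda>j. P j w) \<longlonglongrightarrow> 0"
    and "0 < \<epsilon>"
  shows "\<exists>n. \<forall>j\<ge>n. \<forall>w\<in>S. vanishes_off I W (B n) w \<longrightarrow> P j w \<le> \<epsilon> * vnorm (bounded_product I W) w"
proof -
  define D where "D n = {w \<in> S. vanishes_off I W (B n) w}" for n
  interpret diagonal_system v D "\<lambda>w w'. w \<oplus>\<^bsub>bounded_product I W\<^esub> w'"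
    "\<lambda>c w. c \<odot>\<^bsub>bounded_product I W\<^esub> w" "vnorm (bounded_product I W)" P C
  proof (unfold_locales, goal_cases)
    case (1 p q)
    then show ?case by (rule v_dense)
  next
    case (2 m n)
    then have "B n \<subseteq> B m" using B(1) by (simp add: decseq_def)
    then show ?case by (auto simp: D_def vanishes_off_def)
  next
    case (3 f n t)
    then show ?case using smult_S
      by (auto simp: D_def vanishes_off_def bounded_product_smult smult_zero W)
  next
    case (4 f)
    then show ?case using S by (auto simp: D_def intro!: norm_bounded_product_nonneg)
  next
    case (5 f t)
    then show ?case using S by (auto simp: D_def intro!: norm_smult_bounded_product)
  next
    case (11 n f b)
    then have "\<exists>r. \<forall>m. r m \<in> carrier (bounded_product I W) \<and> vanishes_off I W (B (n m)) (r m) \<and>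
      vnorm (bounded_product I W) (r m) \<le> b m \<and> r m = f m \<oplus>\<^bsub>bounded_product I W\<^esub> r (Suc m)"
      using S by (intro tail_sums_bounded_product [OF B]) (auto simp: D_def)
    then obtain r where r: "\<And>m. r m \<in> carrier (bounded_product I W)"
      "\<And>m. vanishes_off I W (B (n m)) (r m)" "\<And>m. vnorm (bounded_product I W) (r m) \<le> b m"
      "\<And>m. r m = f m \<oplus>\<^bsub>bounded_product I W\<^esub> r (Suc m)" by blast
    have "f m \<in> S" for m using 11(2) by (simp add: D_def)
    then have "r m \<in> S" for m by (rule tails_S [OF 11(1) _ r(1,2,4)])
    then have "r m \<in> D (n m)" for m using r(2) by (simp add: D_def)
    then show ?case using r(3,4) by blast
  qed (auto simp: D_def P_smult P_bound P_add P_add' P_tendsto)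
  show ?thesis using eventually_uniformly_small [OF \<open>0 < \<epsilon>\<close>] by (auto simp: D_def)
qed

end

end

section \<open>Bounded continuous functions on the rationals\<close>

definition scalars :: "('k::field \<Rightarrow> real) \<Rightarrow> ('k, 'k) normed_module" where
  "scalars v = \<lparr>carrier = UNIV, mult = undefined, one = undefined, zero = 0, add = (+),
     smult = (*), vnorm = v\<rparr>"

lemma scalars_simps [simp]:
  "carrier (scalars v) = UNIV" "\<zero>\<^bsub>scalars v\<^esub> = 0" "x \<oplus>\<^bsub>scalars v\<^esub> y = x + y"
  "c \<odot>\<^bsub>scalars v\<^esub> x = c * x" "vnorm (scalars v) = v"
  by (simp_all add: scalars_def)

text \<open>Hence the class \<open>F\<^sub>k\<close> is covered by the results on products: a finite index set is never
  measurable.\<close>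

lemma max_norm_space_eq_bounded_product:
  "max_norm_space v n = bounded_product {..<n} (\<lambda>_. scalars v)"
proof -
  have "Max (insert 0 ((\<lambda>i. v (x i)) ` {..<n})) = Sup (insert 0 ((\<lambda>i. v (x i)) ` {..<n}))" for x
    by (rule cSup_eq_Max [symmetric]) auto
  then show ?thesis
    by (auto simp: max_norm_space_def bounded_product_def scalars_def)
qed

abbreviation bounded_continuous_rat :: "('k::field \<Rightarrow> real) \<Rightarrow> ('k, real \<Rightarrow> 'k) normed_module" where
  "bounded_continuous_rat v \<equiv> bounded_continuous v (top_of_set (\<rat> :: real set))"

definition continuous_at_rat :: "('k::field \<Rightarrow> real) \<Rightarrow> (real \<Rightarrow> 'k) \<Rightarrow> real \<Rightarrow> bool" where
  "continuous_at_rat v f x \<longleftrightarrow> (\<forall>e>0. \<exists>d>0. \<forall>y\<in>\<rat>. \<bar>y - x\<bar> < d \<longrightarrow> v (f y - f x) < e)"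

definition osc_le :: "('k::field \<Rightarrow> real) \<Rightarrow> real set \<Rightarrow> real \<Rightarrow> (real \<Rightarrow> 'k) \<Rightarrow> bool" where
  "osc_le v E e f \<longleftrightarrow> (\<forall>x\<in>E \<inter> \<rat>. \<forall>y\<in>E \<inter> \<rat>. v (f x - f y) \<le> e)"

text \<open>This is the property of an operator on the bounded continuous functions that distinguishes the
  identity from everything that passes through a space of the Reid class. It is local: no matter
  how small a neighbourhood one starts from, one can pass to a smaller open set such that, of
  functions supported there, the operator returns almost constant functions there. The estimate
  persists when the open set shrinks further, and this is why finitely many such operators can be
  dealt with one after the other.\<close>

definition locally_small :: "('k::field \<Rightarrow> real) \<Rightarrow> ((real \<Rightarrow> 'k) \<Rightarrow> real \<Rightarrow> 'k) \<Rightarrow> bool" where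
  "locally_small v T \<longleftrightarrow> (\<forall>e>0. \<forall>D. open D \<and> D \<noteq> {} \<longrightarrow>
     (\<exists>E. open E \<and> E \<noteq> {} \<and> E \<subseteq> D \<and>
        (\<forall>f\<in>carrier (bounded_continuous_rat v). vanishes_off \<rat> (\<lambda>_. scalars v) E f \<longrightarrow>
           osc_le v E (e * vnorm (bounded_continuous_rat v) f) (T f))))"

text \<open>In particular, the identity on the functions supported in a nonempty clopen set does not factor
  through a fragmenting space. Speaking of all compositions rather than of complemented subspaces
  is what makes the property pass from the constituents of a sum or product to the whole.\<close>

definition fragmenting :: "('k::field \<Rightarrow> real) \<Rightarrow> ('k, 'v) normed_module \<Rightarrow> bool" where
  "fragmenting v V \<longleftrightarrow> (\<forall>\<phi> \<psi>. bounded_linear_map (bounded_continuous_rat v) V \<phi> \<longrightarrow>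
     bounded_linear_map V (bounded_continuous_rat v) \<psi> \<longrightarrow> locally_small v (\<psi> \<circ> \<phi>))"

lemma locally_smallE:
  assumes "locally_small v T" "0 < e" "open D" "D \<noteq> {}"
  obtains E where "open E" "E \<noteq> {}" "E \<subseteq> D"
    and "\<And>f. \<lbrakk>f \<in> carrier (bounded_continuous_rat v); vanishes_off \<rat> (\<lambda>_. scalars v) E f\<rbrakk>
      \<Longrightarrow> osc_le v E (e * vnorm (bounded_continuous_rat v) f) (T f)"
  using assms(1) [unfolded locally_small_def, rule_format, of e D] assms(2-) by auto

lemma open_nonempty_obtains_rat:
  assumes "open (D :: real set)" "D \<noteq> {}"
  obtains q d where "q \<in> \<rat>" "0 < d" "ball q d \<subseteq> D"
proof -
  obtain x where "x \<in> D" using assms by blast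
  then obtain e where e: "0 < e" "ball x e \<subseteq> D" using assms(1) open_contains_ball by blast
  obtain q where q: "q \<in> \<rat>" "x < q" "q < x + e"
    using Rats_dense_in_real [of x "x + e"] e(1) by auto
  have "ball q (x + e - q) \<subseteq> ball x e"
    using q(2) by (intro subsetI) (simp add: dist_real_def)
  then have "ball q (x + e - q) \<subseteq> D" using e(2) by (rule subset_trans)
  moreover have "0 < x + e - q" using q(3) by simp
  ultimately show ?thesis using that q(1) by blast
qed

lemma irrational_between:
  assumes "a < (b :: real)"
  obtains r where "a < r" "r < b" "r \<notin> \<rat>"
proof -
  have "uncountable {a<..<b}" using assms by (simp add: uncountable_open_interval)
  then have "\<not> {a<..<b} \<subseteq> \<rat>" using countable_rat countable_subset by blast
  then show ?thesis using that by (auto simp: subset_iff)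
qed

context dense_valuation
begin

abbreviation "CQ \<equiv> bounded_continuous_rat v"

lemma ultranormed_scalars: "ultranormed v (scalars v)"
proof -
  have "module ring_of_type_algebra (scalars v)"
  proof (rule moduleI)
    show "cring (ring_of_type_algebra :: 'k ring)"
      by (rule cring_from_type_algebra)
    show "abelian_group (scalars v)"
    proof (rule abelian_groupI)
      fix x assume "x \<in> carrier (scalars v)"
      show "\<exists>y\<in>carrier (scalars v). y \<oplus>\<^bsub>scalars v\<^esub> x = \<zero>\<^bsub>scalars v\<^esub>"
        by (rule bexI [of _ "- x"]) auto
    qed (auto simp: algebra_simps)
  qed (auto simp: ring_of_type_algebra_def algebra_simps)
  then show ?thesis by (auto simp: ultranormed_def v_mult v_add)
qed

lemma valuation_metric: "Metric_space UNIV (\<lambda>x y. v (x - y))"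
proof
  fix x y z
  show "v (x - z) \<le> v (x - y) + v (y - z)"
    using v_diff_triangle [of x z y] v_nonneg [of "x - y"] v_nonneg [of "y - z"] by linarith
qed (simp_all add: v_diff_commute)

lemma continuous_map_valuation_iff:
  "continuous_map (top_of_set \<rat>) (valuation_topology v) f \<longleftrightarrow> (\<forall>x\<in>\<rat>. continuous_at_rat v f x)"
proof -
  interpret M: Metric_space UNIV "\<lambda>x y. v (x - y)" by (rule valuation_metric)
  have "continuous_map (top_of_set \<rat>) (valuation_topology v) f \<longleftrightarrow>
    (\<forall>x\<in>\<rat>. \<forall>e>0. \<exists>U. openin (top_of_set \<rat>) U \<and> x \<in> U \<and> (\<forall>y\<in>U. v (f x - f y) < e))"
    unfolding valuation_topology_def M.continuous_map_to_metric by simp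
  also have "\<dots> \<longleftrightarrow> (\<forall>x\<in>\<rat>. continuous_at_rat v f x)"
    unfolding continuous_at_rat_def
  proof (intro ball_cong all_cong imp_cong refl iffI)
    fix x e :: real assume x: "x \<in> \<rat>"
    assume "\<exists>U. openin (top_of_set \<rat>) U \<and> x \<in> U \<and> (\<forall>y\<in>U. v (f x - f y) < e)"
    then obtain U where U: "openin (top_of_set \<rat>) U" "x \<in> U" "\<And>y. y \<in> U \<Longrightarrow> v (f x - f y) < e"
      by blast
    then obtain d where "0 < d" "ball x d \<inter> \<rat> \<subseteq> U" 
      using U(1,2) unfolding openin_contains_ball by meson
    then show "\<exists>d>0. \<forall>y\<in>\<rat>. \<bar>y - x\<bar> < d \<longrightarrow> v (f y - f x) < e"
      using U(3) by (intro exI [of _ d])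
        (auto simp: dist_real_def v_diff_commute [of _ "f x"] subset_iff abs_minus_commute)
  next
    fix x e :: real assume x: "x \<in> \<rat>"
    assume "\<exists>d>0. \<forall>y\<in>\<rat>. \<bar>y - x\<bar> < d \<longrightarrow> v (f y - f x) < e"
    then obtain d where "0 < d" "\<And>y. \<lbrakk>y \<in> \<rat>; \<bar>y - x\<bar> < d\<rbrakk> \<Longrightarrow> v (f y - f x) < e" by blast
    then show "\<exists>U. openin (top_of_set \<rat>) U \<and> x \<in> U \<and> (\<forall>y\<in>U. v (f x - f y) < e)"
      using x by (intro exI [of _ "\<rat> \<inter> ball x d"])
        (simp add: dist_real_def v_diff_commute [of "f x"] abs_minus_commute openin_open_Int)
  qed
  finally show ?thesis .
qed

lemma carrier_CQ:
  "carrier CQ = {f \<in> carrier (bounded_product \<rat> (\<lambda>_. scalars v)). \<forall>x\<in>\<rat>. continuous_at_rat v f x}"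
  by (auto simp: bounded_continuous_def bounded_product_def continuous_map_valuation_iff PiE_def)

lemma CQ_in_bounded_product: "f \<in> carrier CQ \<Longrightarrow> f \<in> carrier (bounded_product \<rat> (\<lambda>_. scalars v))"
  by (simp add: carrier_CQ)

lemma CQ_continuous: "\<lbrakk>f \<in> carrier CQ; x \<in> \<rat>\<rbrakk> \<Longrightarrow> continuous_at_rat v f x"
  by (simp add: carrier_CQ)

lemma CQ_add: "f \<oplus>\<^bsub>CQ\<^esub> g = f \<oplus>\<^bsub>bounded_product \<rat> (\<lambda>_. scalars v)\<^esub> g"
  and CQ_smult: "c \<odot>\<^bsub>CQ\<^esub> f = c \<odot>\<^bsub>bounded_product \<rat> (\<lambda>_. scalars v)\<^esub> f"
  and CQ_norm: "vnorm CQ f = vnorm (bounded_product \<rat> (\<lambda>_. scalars v)) f"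
  by (simp_all add: bounded_continuous_def bounded_product_def scalars_def)

lemma CQ_add_apply [simp]: "x \<in> \<rat> \<Longrightarrow> (f \<oplus>\<^bsub>CQ\<^esub> g) x = f x + g x"
  and CQ_smult_apply [simp]: "x \<in> \<rat> \<Longrightarrow> (c \<odot>\<^bsub>CQ\<^esub> f) x = c * f x"
  by (simp_all add: bounded_continuous_def)

lemma CQ_norm_nonneg: "f \<in> carrier CQ \<Longrightarrow> 0 \<le> vnorm CQ f"
  unfolding CQ_norm by (intro norm_bounded_product_nonneg CQ_in_bounded_product)

lemma CQ_le_norm: "\<lbrakk>f \<in> carrier CQ; x \<in> \<rat>\<rbrakk> \<Longrightarrow> v (f x) \<le> vnorm CQ f"
  using component_le_norm [OF CQ_in_bounded_product, of f x] by (simp add: CQ_norm)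

lemma continuous_at_rat_add:
  assumes "continuous_at_rat v f x" "continuous_at_rat v g x" "x \<in> \<rat>"
    and h: "\<And>y. y \<in> \<rat> \<Longrightarrow> h y = f y + g y"
  shows "continuous_at_rat v h x"
  unfolding continuous_at_rat_def
proof (intro allI impI)
  fix e :: real assume "0 < e"
  obtain d where d: "0 < d" "\<And>y. \<lbrakk>y \<in> \<rat>; \<bar>y - x\<bar> < d\<rbrakk> \<Longrightarrow> v (f y - f x) < e"
    using assms(1) \<open>0 < e\<close> unfolding continuous_at_rat_def by blast
  obtain d' where d': "0 < d'" "\<And>y. \<lbrakk>y \<in> \<rat>; \<bar>y - x\<bar> < d'\<rbrakk> \<Longrightarrow> v (g y - g x) < e"
    using assms(2) \<open>0 < e\<close> unfolding continuous_at_rat_def by blast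
  have "v (h y - h x) < e" if "y \<in> \<rat>" "\<bar>y - x\<bar> < min d d'" for y
  proof -
    have "h y - h x = (f y - f x) + (g y - g x)" using h that(1) \<open>x \<in> \<rat>\<close> by simp
    then have "v (h y - h x) \<le> max (v (f y - f x)) (v (g y - g x))" using v_add by simp
    then show ?thesis using d(2) [of y] d'(2) [of y] that by simp
  qed
  then show "\<exists>d>0. \<forall>y\<in>\<rat>. \<bar>y - x\<bar> < d \<longrightarrow> v (h y - h x) < e"
    using d(1) d'(1) by (intro exI [of _ "min d d'"]) auto
qed

lemma CQ_smult_closed:
  assumes "f \<in> carrier CQ"
  shows "c \<odot>\<^bsub>CQ\<^esub> f \<in> carrier CQ"
proof -
  have "continuous_at_rat v (c \<odot>\<^bsub>CQ\<^esub> f) x" if "x \<in> \<rat>" for x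
  proof (cases "c = 0")
    case True
    then show ?thesis using that by (auto simp: continuous_at_rat_def intro: exI [of _ 1])
  next
    case False
    then have "0 < v c" using v_nonneg [of c] v_eq_0_iff [of c] by linarith
    show ?thesis unfolding continuous_at_rat_def
    proof (intro allI impI)
      fix e :: real assume "0 < e"
      then have "0 < e / v c" using \<open>0 < v c\<close> by simp
      then obtain d where d: "0 < d" "\<And>y. \<lbrakk>y \<in> \<rat>; \<bar>y - x\<bar> < d\<rbrakk> \<Longrightarrow> v (f y - f x) < e / v c"
        using CQ_continuous [OF assms \<open>x \<in> \<rat>\<close>] unfolding continuous_at_rat_def by blast
      have "v (c * f y - c * f x) < e" if "y \<in> \<rat>" "\<bar>y - x\<bar> < d" for y
      proof -
        have "v (c * f y - c * f x) = v c * v (f y - f x)"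
          using v_mult [of c "f y - f x"] by (simp only: right_diff_distrib)
        then show ?thesis using d(2) [OF that] \<open>0 < v c\<close> by (simp add: pos_less_divide_eq mult.commute)
      qed
      then show "\<exists>d>0. \<forall>y\<in>\<rat>. \<bar>y - x\<bar> < d \<longrightarrow> v ((c \<odot>\<^bsub>CQ\<^esub> f) y - (c \<odot>\<^bsub>CQ\<^esub> f) x) < e"
        using d(1) \<open>x \<in> \<rat>\<close> by (intro exI [of _ d]) auto
    qed
  qed
  then show ?thesis
    using assms smult_bounded_product_closed [of \<rat> "\<lambda>_. scalars v" f c] ultranormed_scalars
    by (simp add: carrier_CQ CQ_smult)
qed

text \<open>Near a rational point all but finitely many of the terms vanish, so a tail sum is
  continuous there.\<close>

lemma CQ_tail_sums_closed:
  assumes B: "decseq B" and far: "\<And>x. x \<in> \<rat> \<Longrightarrow> \<exists>k. \<exists>d>0. \<forall>y. \<bar>y - x\<bar> < d \<longrightarrow> y \<notin> B k"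
    and n: "strict_mono n" and f: "\<And>m. f m \<in> carrier CQ"
    and r: "\<And>m. r m \<in> carrier (bounded_product \<rat> (\<lambda>_. scalars v))"
      "\<And>m. vanishes_off \<rat> (\<lambda>_. scalars v) (B (n m)) (r m)"
      "\<And>m. r m = f m \<oplus>\<^bsub>bounded_product \<rat> (\<lambda>_. scalars v)\<^esub> r (Suc m)"
  shows "r m \<in> carrier CQ"
proof -
  have "continuous_at_rat v (r m) x" if "x \<in> \<rat>" for x
  proof -
    obtain k d where k: "0 < d" "\<And>y. \<bar>y - x\<bar> < d \<Longrightarrow> y \<notin> B k" using far [OF \<open>x \<in> \<rat>\<close>] by blast
    have late: "continuous_at_rat v (r l) x" if "k \<le> l" for l
    proof -
      have "k \<le> n l" using that strict_mono_imp_increasing [OF n, of l] by linarith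
      then have "B (n l) \<subseteq> B k" using B by (simp add: decseq_def)
      then have "r l y = 0" if "y \<in> \<rat>" "\<bar>y - x\<bar> < d" for y
        using r(2) [of l] k(2) [of y] that by (auto simp: vanishes_off_def)
      then show ?thesis using k(1) \<open>x \<in> \<rat>\<close> unfolding continuous_at_rat_def
        by (intro allI impI exI [of _ d]) auto
    qed
    have step: "continuous_at_rat v (r l) x" if "continuous_at_rat v (r (Suc l)) x" for l
    proof (rule continuous_at_rat_add [OF CQ_continuous [OF f \<open>x \<in> \<rat>\<close>] that \<open>x \<in> \<rat>\<close>])
      fix y :: real assume "y \<in> \<rat>"
      then show "r l y = f l y + r (Suc l) y" by (subst r(3)) (simp add: bounded_product_add)
    qed
    have "m \<le> max m k" by simp
    then show ?thesis by (induction rule: inc_induct) (simp_all add: late step)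
  qed
  then show ?thesis using r(1) by (simp add: carrier_CQ)
qed

lemma osc_le_add:
  assumes "osc_le v E e f" "osc_le v E e g"
  shows "osc_le v E e (f \<oplus>\<^bsub>CQ\<^esub> g)"
  unfolding osc_le_def
proof (intro ballI)
  fix x y assume xy: "x \<in> E \<inter> \<rat>" "y \<in> E \<inter> \<rat>"
  have "(f \<oplus>\<^bsub>CQ\<^esub> g) x - (f \<oplus>\<^bsub>CQ\<^esub> g) y = (f x - f y) + (g x - g y)" using xy by simp
  also have "v \<dots> \<le> max (v (f x - f y)) (v (g x - g y))" by (rule v_add)
  also have "\<dots> \<le> e" using assms xy by (simp add: osc_le_def)
  finally show "v ((f \<oplus>\<^bsub>CQ\<^esub> g) x - (f \<oplus>\<^bsub>CQ\<^esub> g) y) \<le> e" .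
qed

lemma osc_le_subset: "\<lbrakk>osc_le v E e f; E' \<subseteq> E; e \<le> e'\<rbrakk> \<Longrightarrow> osc_le v E' e' f"
  unfolding osc_le_def by (meson IntD1 IntD2 IntI in_mono order_trans)

lemma osc_le_of_center:
  assumes "\<And>x. x \<in> E \<inter> \<rat> \<Longrightarrow> v (f x - f q) \<le> e"
  shows "osc_le v E e f"
  unfolding osc_le_def
proof (intro ballI)
  fix x y assume "x \<in> E \<inter> \<rat>" "y \<in> E \<inter> \<rat>"
  then have "v (f x - f q) \<le> e" "v (f q - f y) \<le> e" using assms by (auto simp: v_diff_commute [of "f q"])
  then show "v (f x - f y) \<le> e" using v_diff_triangle [of "f x" "f y" "f q"] by linarith
qed

lemma osc_le_norm: "f \<in> carrier CQ \<Longrightarrow> osc_le v E (vnorm CQ f) f"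
  unfolding osc_le_def
proof (intro ballI)
  fix x y assume f: "f \<in> carrier CQ" and "x \<in> E \<inter> \<rat>" "y \<in> E \<inter> \<rat>"
  then have "v (f x) \<le> vnorm CQ f" "v (f y) \<le> vnorm CQ f" using CQ_le_norm by auto
  then show "v (f x - f y) \<le> vnorm CQ f" using v_add [of "f x" "- f y"] by simp
qed

text \<open>Every nonempty open set contains a clopen interval, cut out by irrational end points, and a
  rational point outside of this interval. The indicator function of the interval is supported in
  the open set and oscillates there by its full norm.\<close>

lemma not_locally_small_id:
  shows "\<not> locally_small v (\<lambda>f. f)"
proof
  assume "locally_small v (\<lambda>f. f)"
  then obtain E where E: "open E" "E \<noteq> {}"
    and osc: "\<And>f. \<lbrakk>f \<in> carrier CQ; vanishes_off \<rat> (\<lambda>_. scalars v) E f\<rbrakk>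
      \<Longrightarrow> osc_le v E (1 / 2 * vnorm CQ f) f"
    by (rule locally_smallE [of _ _ "1 / 2" UNIV]) auto
  obtain q d where q: "q \<in> \<rat>" "0 < d" "ball q d \<subseteq> E" using open_nonempty_obtains_rat [OF E] .
  obtain a where a: "q - d < a" "a < q" "a \<notin> \<rat>" using irrational_between [of "q - d" q] q(2) by auto
  obtain b where b: "q < b" "b < q + d" "b \<notin> \<rat>" using irrational_between [of q "q + d"] q(2) by auto
  obtain p where p: "p \<in> \<rat>" "b < p" "p < q + d" using Rats_dense_in_real [OF b(2)] by blast
  define f where "f = (\<lambda>x\<in>\<rat>. if a < x \<and> x < b then 1 else 0 :: 'k)"
  have "continuous_at_rat v f x" if "x \<in> \<rat>" for x
  proof -
    have "x \<noteq> a" "x \<noteq> b" using that a(3) b(3) by auto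
    define d' where "d' = min \<bar>x - a\<bar> \<bar>x - b\<bar>"
    have "0 < d'" using \<open>x \<noteq> a\<close> \<open>x \<noteq> b\<close> by (simp add: d'_def)
    moreover have "f y = f x" if "y \<in> \<rat>" "\<bar>y - x\<bar> < d'" for y
      using that \<open>x \<in> \<rat>\<close> by (auto simp: f_def d'_def)
    ultimately show ?thesis unfolding continuous_at_rat_def
      by (intro allI impI exI [of _ d']) auto
  qed
  moreover have "f \<in> carrier (bounded_product \<rat> (\<lambda>_. scalars v))"
    by (rule bounded_productI [where b = 1]) (auto simp: f_def)
  ultimately have f: "f \<in> carrier CQ" by (simp add: carrier_CQ)
  have norm: "vnorm CQ f \<le> 1"
    unfolding CQ_norm by (rule norm_bounded_product_le) (auto simp: f_def)
  have "x \<in> E" if "a < x" "x < b" for x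
    using that a b q(3) by (force simp: dist_real_def subset_iff)
  then have "vanishes_off \<rat> (\<lambda>_. scalars v) E f" by (auto simp: vanishes_off_def f_def)
  then have "osc_le v E (1 / 2 * vnorm CQ f) f" using osc f by blast
  moreover have "q \<in> E" "p \<in> E" using p b q by (auto simp: dist_real_def subset_iff)
  ultimately have "v (f q - f p) \<le> 1 / 2 * vnorm CQ f" using q(1) p(1) by (auto simp: osc_le_def)
  moreover have "f q - f p = 1" using q(1) p a b by (simp add: f_def)
  ultimately show False using norm by simp
qed

corollary not_fragmenting_CQ: "\<not> fragmenting v CQ"
proof
  have "bounded_linear_map CQ CQ (\<lambda>f. f)"
    unfolding bounded_linear_map_def by (auto intro: exI [of _ 1])
  moreover assume "fragmenting v CQ"
  ultimately have "locally_small v ((\<lambda>f. f) \<circ> (\<lambda>f. f))" unfolding fragmenting_def by blast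
  then show False using not_locally_small_id by (simp add: comp_def)
qed

text \<open>A map from the scalars is determined by the function \<open>\<psi> 1\<close>, which is almost constant near any
  given point since it is continuous there.\<close>

lemma fragmenting_scalars: "fragmenting v (scalars v)"
  unfolding fragmenting_def
proof (intro allI impI)
  fix \<phi> \<psi> assume \<phi>: "bounded_linear_map CQ (scalars v) \<phi>" and \<psi>: "bounded_linear_map (scalars v) CQ \<psi>"
  obtain C where C: "0 < C" "\<And>f. f \<in> carrier CQ \<Longrightarrow> v (\<phi> f) \<le> C * vnorm CQ f"
    using \<phi> by (auto simp: bounded_linear_map_def)
  have \<psi>1: "\<psi> 1 \<in> carrier CQ" using \<psi> by (simp add: bounded_linear_map_def)
  have \<psi>_eq: "\<psi> t = t \<odot>\<^bsub>CQ\<^esub> \<psi> 1" for t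
    using \<psi> unfolding bounded_linear_map_def scalars_simps by (metis UNIV_I mult.right_neutral)
  show "locally_small v (\<psi> \<circ> \<phi>)"
    unfolding locally_small_def
  proof (intro allI impI, elim conjE)
    fix e and D :: "real set" assume "0 < (e :: real)" "open D" "D \<noteq> {}"
    then obtain q d where q: "q \<in> \<rat>" "0 < d" "ball q d \<subseteq> D" using open_nonempty_obtains_rat by blast
    have "0 < e / C" using \<open>0 < e\<close> C(1) by simp
    then obtain d' where d': "0 < d'" "\<And>y. \<lbrakk>y \<in> \<rat>; \<bar>y - q\<bar> < d'\<rbrakk> \<Longrightarrow> v (\<psi> 1 y - \<psi> 1 q) < e / C"
      using CQ_continuous [OF \<psi>1 q(1)] unfolding continuous_at_rat_def by blast
    define E where "E = ball q (min d d')"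
    have "osc_le v E (e * vnorm CQ f) ((\<psi> \<circ> \<phi>) f)" if f: "f \<in> carrier CQ" for f
    proof (rule osc_le_of_center [of _ _ q])
      fix x assume x: "x \<in> E \<inter> \<rat>"
      have "(\<psi> \<circ> \<phi>) f x - (\<psi> \<circ> \<phi>) f q = \<phi> f * (\<psi> 1 x - \<psi> 1 q)"
        using x q(1) by (simp add: \<psi>_eq [of "\<phi> f"] algebra_simps)
      also have "v \<dots> = v (\<phi> f) * v (\<psi> 1 x - \<psi> 1 q)" by (rule v_mult)
      also have "\<dots> \<le> (C * vnorm CQ f) * (e / C)"
        using C f d'(2) [of x] x CQ_norm_nonneg [OF f]
        by (intro mult_mono) (auto simp: E_def dist_real_def abs_minus_commute less_imp_le)
      also have "\<dots> = e * vnorm CQ f" using C(1) by simp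
      finally show "v ((\<psi> \<circ> \<phi>) f x - (\<psi> \<circ> \<phi>) f q) \<le> e * vnorm CQ f" .
    qed
    moreover have "open E" "E \<noteq> {}" "E \<subseteq> D" using q d'(1) by (auto simp: E_def subset_iff)
    ultimately show "\<exists>E. open E \<and> E \<noteq> {} \<and> E \<subseteq> D \<and>
        (\<forall>f\<in>carrier CQ. vanishes_off \<rat> (\<lambda>_. scalars v) E f \<longrightarrow>
           osc_le v E (e * vnorm CQ f) ((\<psi> \<circ> \<phi>) f))" by blast
  qed
qed

lemma locally_small_finite:
  assumes "finite F" "\<And>i. i \<in> F \<Longrightarrow> locally_small v (T i)" "0 < e" "open D" "D \<noteq> {}"
  shows "\<exists>E. open E \<and> E \<noteq> {} \<and> E \<subseteq> D \<and>
    (\<forall>i\<in>F. \<forall>f\<in>carrier CQ. vanishes_off \<rat> (\<lambda>_. scalars v) E f \<longrightarrow> osc_le v E (e * vnorm CQ f) (T i f))"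
  using assms(1,2)
proof (induction F)
  case empty
  then show ?case using assms(4,5) by auto
next
  case (insert j F)
  then obtain E where E: "open E" "E \<noteq> {}" "E \<subseteq> D"
    and E_osc: "\<And>i f. \<lbrakk>i \<in> F; f \<in> carrier CQ; vanishes_off \<rat> (\<lambda>_. scalars v) E f\<rbrakk>
      \<Longrightarrow> osc_le v E (e * vnorm CQ f) (T i f)" by (metis insertCI)
  have "locally_small v (T j)" using insert.prems by simp
  then obtain E' where E': "open E'" "E' \<noteq> {}" "E' \<subseteq> E"
    and E'_osc: "\<And>f. \<lbrakk>f \<in> carrier CQ; vanishes_off \<rat> (\<lambda>_. scalars v) E' f\<rbrakk>
      \<Longrightarrow> osc_le v E' (e * vnorm CQ f) (T j f)"
    using \<open>0 < e\<close> E(1,2) by (rule locally_smallE) blast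
  have "osc_le v E' (e * vnorm CQ f) (T i f)"
    if "i \<in> insert j F" "f \<in> carrier CQ" and f: "vanishes_off \<rat> (\<lambda>_. scalars v) E' f" for i f
  proof (cases "i = j")
    case True
    then show ?thesis using E'_osc that by blast
  next
    case False
    have "vanishes_off \<rat> (\<lambda>_. scalars v) E f" using f E'(3) by (auto simp: vanishes_off_def)
    then show ?thesis using osc_le_subset [OF E_osc E'(3) order_refl] that False by blast
  qed
  then show ?case using E' E(3) by (intro exI [of _ E']) auto
qed

section \<open>Sums and products of fragmenting spaces\<close>

context
  fixes I :: "'i set" and W :: "'i \<Rightarrow> ('k, 'v) normed_module"
  assumes W: "\<And>i. i \<in> I \<Longrightarrow> ultranormed v (W i)"
    and W_fragmenting: "\<And>i. i \<in> I \<Longrightarrow> fragmenting v (W i)"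
begin

text \<open>The common part of the arguments for sums and products. If up to a small error the composition
  \<open>\<psi> \<circ> \<phi>\<close> only sees finitely many coordinates, then it is the sum of the finitely many
  compositions through these coordinates, and each of them is locally small by hypothesis.\<close>

lemma fragmenting_subproduct:
  assumes S: "S \<subseteq> carrier (bounded_product I W)"
    and cutoff_S: "\<And>w A. w \<in> S \<Longrightarrow> cutoff I W A w \<in> S"
    and single_S: "\<And>i x. \<lbrakk>i \<in> I; x \<in> carrier (W i)\<rbrakk> \<Longrightarrow> single I W i x \<in> S"
    and finite_reduction: "\<And>\<phi> \<psi> e D. \<lbrakk>bounded_linear_map CQ (subproduct I W S) \<phi>;
        bounded_linear_map (subproduct I W S) CQ \<psi>; 0 < e; open D; D \<noteq> {}\<rbrakk>
      \<Longrightarrow> \<exists>F E. finite F \<and> F \<subseteq> I \<and> open E \<and> E \<noteq> {} \<and> E \<subseteq> D \<and>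
        (\<forall>f\<in>carrier CQ. vanishes_off \<rat> (\<lambda>_. scalars v) E f \<longrightarrow>
           osc_le v E (e * vnorm CQ f) (\<psi> (cutoff I W (I - F) (\<phi> f))))"
  shows "fragmenting v (subproduct I W S)"
  unfolding fragmenting_def
proof (intro allI impI)
  fix \<phi> \<psi> assume \<phi>: "bounded_linear_map CQ (subproduct I W S) \<phi>"
    and \<psi>: "bounded_linear_map (subproduct I W S) CQ \<psi>"
  have single_linear: "bounded_linear_map (W i) (subproduct I W S) (single I W i)" if i: "i \<in> I" for i
  proof -
    have "vnorm (bounded_product I W) (single I W i x) \<le> vnorm (W i) x" if "x \<in> carrier (W i)" for x
      using that norm_nonneg [OF W [OF i]]
      by (intro norm_bounded_product_le) (auto simp: single_def norm_zero W)
    then have "\<exists>C>0. \<forall>x\<in>carrier (W i). vnorm (bounded_product I W) (single I W i x) \<le> C * vnorm (W i) x"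
      by (intro exI [of _ 1]) simp
    moreover have "single I W i (x \<oplus>\<^bsub>W i\<^esub> y) =
        single I W i x \<oplus>\<^bsub>bounded_product I W\<^esub> single I W i y" for x y
      using W by (auto simp: bounded_product_add single_def fun_eq_iff add_zero zero_closed)
    moreover have "single I W i (c \<odot>\<^bsub>W i\<^esub> x) = c \<odot>\<^bsub>bounded_product I W\<^esub> single I W i x" for c x
      using W by (auto simp: bounded_product_smult single_def fun_eq_iff smult_zero)
    ultimately show ?thesis using single_S [OF i] by (simp add: bounded_linear_map_def)
  qed
  have component_linear: "bounded_linear_map (subproduct I W S) (W i) (\<lambda>w. w i)" if i: "i \<in> I" for i
  proof -
    have "vnorm (W i) (w i) \<le> vnorm (bounded_product I W) w" if "w \<in> S" for w
      using component_le_norm [OF _ i] S that by blast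
    then have "\<exists>C>0. \<forall>w\<in>S. vnorm (W i) (w i) \<le> C * vnorm (bounded_product I W) w"
      by (intro exI [of _ 1]) simp
    moreover have "w i \<in> carrier (W i)" if "w \<in> S" for w
      using component_closed [OF _ i] S that by blast
    ultimately show ?thesis
      using i by (simp add: bounded_linear_map_def bounded_product_add bounded_product_smult)
  qed
  define T where "T i = (\<psi> \<circ> single I W i) \<circ> ((\<lambda>w. w i) \<circ> \<phi>)" for i
  have T_small: "locally_small v (T i)" if i: "i \<in> I" for i
    unfolding T_def
    using W_fragmenting [OF i] bounded_linear_map_comp [OF \<phi> component_linear [OF i]]
      bounded_linear_map_comp [OF single_linear [OF i] \<psi>]
    by (simp add: fragmenting_def)
  have assemble: "osc_le v E e (\<psi> w)"
    if "finite F" "F \<subseteq> I" and w: "w \<in> S" and "\<And>i. i \<in> F \<Longrightarrow> osc_le v E e (\<psi> (single I W i (w i)))"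
      and "osc_le v E e (\<psi> (cutoff I W (I - F) w))" for F E e w
    using that(1,2,4,5)
  proof (induction F)
    case empty
    have "cutoff I W I w = w" using w S by (intro cutoff_id) (auto simp: vanishes_off_def)
    then show ?case using empty by simp
  next
    case (insert j F)
    have j: "I - F = {j} \<union> (I - insert j F)" using insert.hyps insert.prems(1) by blast
    have "cutoff I W (I - F) w =
        cutoff I W {j} w \<oplus>\<^bsub>bounded_product I W\<^esub> cutoff I W (I - insert j F) w"
      unfolding j using w S by (intro cutoff_split W) auto
    then have "\<psi> (cutoff I W (I - F) w) = \<psi> (cutoff I W {j} w) \<oplus>\<^bsub>CQ\<^esub> \<psi> (cutoff I W (I - insert j F) w)"
      using \<psi> cutoff_S [OF w] by (simp add: bounded_linear_map_def)
    moreover have "osc_le v E e (\<psi> (cutoff I W {j} w))"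
      using insert.prems(2) [of j] by (simp add: cutoff_singleton)
    ultimately have "osc_le v E e (\<psi> (cutoff I W (I - F) w))"
      using osc_le_add insert.prems(3) by simp
    then show ?case using insert.IH insert.prems by simp
  qed
  show "locally_small v (\<psi> \<circ> \<phi>)"
    unfolding locally_small_def
  proof (intro allI impI, elim conjE)
    fix e and D :: "real set" assume "0 < (e :: real)" "open D" "D \<noteq> {}"
    then obtain F E0 where F: "finite F" "F \<subseteq> I" and E0: "open E0" "E0 \<noteq> {}" "E0 \<subseteq> D"
      and E0_osc: "\<And>f. \<lbrakk>f \<in> carrier CQ; vanishes_off \<rat> (\<lambda>_. scalars v) E0 f\<rbrakk>
        \<Longrightarrow> osc_le v E0 (e * vnorm CQ f) (\<psi> (cutoff I W (I - F) (\<phi> f)))"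
      using finite_reduction [OF \<phi> \<psi>] by metis
    have "\<And>i. i \<in> F \<Longrightarrow> locally_small v (T i)" using T_small F(2) by blast
    then obtain E where E: "open E" "E \<noteq> {}" "E \<subseteq> E0"
      and E_osc: "\<And>i f. \<lbrakk>i \<in> F; f \<in> carrier CQ; vanishes_off \<rat> (\<lambda>_. scalars v) E f\<rbrakk>
        \<Longrightarrow> osc_le v E (e * vnorm CQ f) (T i f)"
      using locally_small_finite [OF F(1) _ \<open>0 < e\<close> E0(1,2)] by metis
    have "osc_le v E (e * vnorm CQ f) ((\<psi> \<circ> \<phi>) f)"
      if f: "f \<in> carrier CQ" "vanishes_off \<rat> (\<lambda>_. scalars v) E f" for f
    proof -
      have "\<phi> f \<in> S" using \<phi> f(1) by (simp add: bounded_linear_map_def)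
      moreover have "osc_le v E (e * vnorm CQ f) (\<psi> (single I W i (\<phi> f i)))" if "i \<in> F" for i
        using E_osc [OF that f] by (simp add: T_def)
      moreover have "vanishes_off \<rat> (\<lambda>_. scalars v) E0 f"
        using f(2) E(3) by (auto simp: vanishes_off_def)
      then have "osc_le v E (e * vnorm CQ f) (\<psi> (cutoff I W (I - F) (\<phi> f)))"
        using osc_le_subset [OF E0_osc [OF f(1)] E(3) order_refl] by blast
      ultimately show ?thesis using assemble [OF F] by simp
    qed
    then show "\<exists>E. open E \<and> E \<noteq> {} \<and> E \<subseteq> D \<and>
        (\<forall>f\<in>carrier CQ. vanishes_off \<rat> (\<lambda>_. scalars v) E f \<longrightarrow>
           osc_le v E (e * vnorm CQ f) ((\<psi> \<circ> \<phi>) f))"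
      using E E0(3) by (intro exI [of _ E]) auto
  qed
qed

text \<open>The Chase lemma for the norms of the components of \<open>\<phi> f\<close>, which tend to \<open>0\<close> along any sequence
  of distinct indices because \<open>\<phi> f\<close> lies in the completed sum. If the claim fails, it fails
  along such a sequence.\<close>

lemma components_uniformly_small:
  assumes \<phi>: "bounded_linear_map CQ (completed_sum I W) \<phi>" and "0 < \<epsilon>"
    and B: "decseq B" "(\<Inter>n. B n) = {}"
    and far: "\<And>x. x \<in> \<rat> \<Longrightarrow> \<exists>k. \<exists>d>0. \<forall>y. \<bar>y - x\<bar> < d \<longrightarrow> y \<notin> B k"
  shows "\<exists>n F. finite F \<and> F \<subseteq> I \<and> (\<forall>i\<in>I - F. \<forall>f\<in>carrier CQ.
    vanishes_off \<rat> (\<lambda>_. scalars v) (B n) f \<longrightarrow> vnorm (W i) (\<phi> f i) \<le> \<epsilon> * vnorm CQ f)"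
proof (rule ccontr)
  assume no: "\<not> ?thesis"
  define bad where "bad n i \<longleftrightarrow> (\<exists>f\<in>carrier CQ. vanishes_off \<rat> (\<lambda>_. scalars v) (B n) f \<and>
    \<epsilon> * vnorm CQ f < vnorm (W i) (\<phi> f i))" for n i
  have bad_ex: "\<exists>i\<in>I - F. bad n i" if "finite F" "F \<subseteq> I" for n F
    using no that unfolding bad_def by (meson not_le)
  have "\<exists>s. \<forall>n. (case s n of (F, i) \<Rightarrow> finite F \<and> F \<subseteq> I \<and> i \<in> I - F \<and> bad n i) \<and>
    fst (s (Suc n)) = insert (snd (s n)) (fst (s n))"
  proof (rule dependent_nat_choice)
    show "\<exists>s. case s of (F, i) \<Rightarrow> finite F \<and> F \<subseteq> I \<and> i \<in> I - F \<and> bad 0 i"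
      using bad_ex [of "{}" 0] by (intro exI [of _ "({}, SOME i. i \<in> I \<and> bad 0 i)"]) (auto intro: someI2_ex)
  next
    fix s :: "'i set \<times> 'i" and n
    assume s: "case s of (F, i) \<Rightarrow> finite F \<and> F \<subseteq> I \<and> i \<in> I - F \<and> bad n i"
    then obtain i where "i \<in> I - insert (snd s) (fst s)" "bad (Suc n) i"
      using bad_ex [of "insert (snd s) (fst s)" "Suc n"] by (auto simp: case_prod_beta)
    then show "\<exists>s'. (case s' of (F, i) \<Rightarrow> finite F \<and> F \<subseteq> I \<and> i \<in> I - F \<and> bad (Suc n) i) \<and>
        fst s' = insert (snd s) (fst s)"
      using s by (intro exI [of _ "(insert (snd s) (fst s), i)"]) (auto simp: case_prod_beta)
  qed
  then obtain s where s: "\<And>n. snd (s n) \<in> I - fst (s n)" "\<And>n. bad n (snd (s n))"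
    "\<And>n. fst (s (Suc n)) = insert (snd (s n)) (fst (s n))"
    by (auto simp: case_prod_beta)
  define i where "i n = snd (s n)" for n
  have i_I: "i n \<in> I" and i_bad: "bad n (i n)" for n using s(1,2) [of n] by (auto simp: i_def)
  have earlier: "i m \<in> fst (s n)" if "m < n" for m n
    using that by (induction n) (auto simp: s(3) i_def less_Suc_eq)
  have "i m \<noteq> i n" if "m < n" for m n
    using earlier [OF that] s(1) [of n] by (auto simp: i_def)
  then have inj: "inj i" by (metis injI linorder_neqE_nat)
  define P where "P n f = vnorm (W (i n)) (\<phi> f (i n))" for n f
  obtain C where C: "\<And>f. f \<in> carrier CQ \<Longrightarrow> vnorm (completed_sum I W) (\<phi> f) \<le> C * vnorm CQ f"
    using \<phi> unfolding bounded_linear_map_def by blast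
  have \<phi>_sum: "\<phi> f \<in> carrier (completed_sum I W)" if "f \<in> carrier CQ" for f
    using \<phi> that by (simp add: bounded_linear_map_def)
  then have \<phi>_prod: "\<phi> f \<in> carrier (bounded_product I W)" if "f \<in> carrier CQ" for f
    using that by (simp add: carrier_completed_sum)
  have \<phi>_comp: "\<phi> f (i n) \<in> carrier (W (i n))" if "f \<in> carrier CQ" for f n
    using component_closed [OF \<phi>_prod [OF that] i_I] .
  have \<phi>_add: "\<phi> (f \<oplus>\<^bsub>CQ\<^esub> g) (i n) = \<phi> f (i n) \<oplus>\<^bsub>W (i n)\<^esub> \<phi> g (i n)"
    if "f \<in> carrier CQ" "g \<in> carrier CQ" for f g n
    using \<phi> that i_I by (simp add: bounded_linear_map_def completed_sum_def bounded_product_add)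
  have "\<exists>n. \<forall>j\<ge>n. \<forall>f\<in>carrier CQ. vanishes_off \<rat> (\<lambda>_. scalars v) (B n) f \<longrightarrow>
      P j f \<le> \<epsilon> * vnorm (bounded_product \<rat> (\<lambda>_. scalars v)) f"
  proof (rule chase_subproduct [where C = C, OF ultranormed_scalars B])
    show "carrier CQ \<subseteq> carrier (bounded_product \<rat> (\<lambda>_. scalars v))"
      using CQ_in_bounded_product by blast
    show "c \<odot>\<^bsub>bounded_product \<rat> (\<lambda>_. scalars v)\<^esub> f \<in> carrier CQ" if "f \<in> carrier CQ" for c f
      using CQ_smult_closed [OF that] by (simp add: CQ_smult)
    show "r m \<in> carrier CQ" if "strict_mono n" "\<And>m. f m \<in> carrier CQ"
      "\<And>m. r m \<in> carrier (bounded_product \<rat> (\<lambda>_. scalars v))"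
      "\<And>m. vanishes_off \<rat> (\<lambda>_. scalars v) (B (n m)) (r m)"
      "\<And>m. r m = f m \<oplus>\<^bsub>bounded_product \<rat> (\<lambda>_. scalars v)\<^esub> r (Suc m)" for n f r m
      by (rule CQ_tail_sums_closed [OF B(1) far that])
    show "P j (c \<odot>\<^bsub>bounded_product \<rat> (\<lambda>_. scalars v)\<^esub> f) = v c * P j f" if "f \<in> carrier CQ" for j c f
    proof -
      have "\<phi> (c \<odot>\<^bsub>CQ\<^esub> f) (i j) = c \<odot>\<^bsub>W (i j)\<^esub> \<phi> f (i j)"
        using \<phi> that i_I by (simp add: bounded_linear_map_def completed_sum_def bounded_product_smult)
      then show ?thesis using norm_smult [OF W [OF i_I] \<phi>_comp [OF that]] by (simp add: P_def CQ_smult)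
    qed
    show "P j f \<le> C * vnorm (bounded_product \<rat> (\<lambda>_. scalars v)) f" if "f \<in> carrier CQ" for j f
      using component_le_norm [OF \<phi>_prod [OF that] i_I [of j]] C [OF that]
      by (simp add: P_def CQ_norm completed_sum_def)
    show "P j f \<le> max (P j (f \<oplus>\<^bsub>bounded_product \<rat> (\<lambda>_. scalars v)\<^esub> g)) (P j g)"
      if "f \<in> carrier CQ" "g \<in> carrier CQ" for j f g
      using norm_le_max_add [OF W [OF i_I] \<phi>_comp [OF that(1)] \<phi>_comp [OF that(2)]] \<phi>_add [OF that]
      by (simp add: P_def CQ_add)
    show "P j g \<le> max (P j (f \<oplus>\<^bsub>bounded_product \<rat> (\<lambda>_. scalars v)\<^esub> g)) (P j f)"
      if "f \<in> carrier CQ" "g \<in> carrier CQ" for j f g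
      using norm_le_max_add' [OF W [OF i_I] \<phi>_comp [OF that(1)] \<phi>_comp [OF that(2)]] \<phi>_add [OF that]
      by (simp add: P_def CQ_add)
    show "(\<lambda>j. P j f) \<longlonglongrightarrow> 0" if f: "f \<in> carrier CQ" for f
    proof (rule LIMSEQ_I)
      fix e :: real assume "0 < e"
      then have "finite {l \<in> I. e \<le> vnorm (W l) (\<phi> f l)}"
        using \<phi>_sum [OF f] by (simp add: carrier_completed_sum)
      then have "finite (i -` {l \<in> I. e \<le> vnorm (W l) (\<phi> f l)})" using inj by (rule finite_vimageI)
      then obtain m where "\<forall>n\<in>i -` {l \<in> I. e \<le> vnorm (W l) (\<phi> f l)}. n < m"
        using finite_nat_set_iff_bounded by blast
      then have "P n f < e" if "m \<le> n" for n using that i_I [of n] by (force simp: P_def)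
      moreover have "0 \<le> P n f" for n using norm_nonneg [OF W [OF i_I] \<phi>_comp [OF f]] by (simp add: P_def)
      ultimately show "\<exists>m. \<forall>n\<ge>m. norm (P n f - 0) < e" by auto
    qed
  qed fact
  then obtain n where n: "\<And>f. \<lbrakk>f \<in> carrier CQ; vanishes_off \<rat> (\<lambda>_. scalars v) (B n) f\<rbrakk>
      \<Longrightarrow> P n f \<le> \<epsilon> * vnorm CQ f"
    by (auto simp: CQ_norm)
  show False using i_bad [of n] n by (force simp: bad_def P_def)
qed

lemma cutoff_completed_sum_closed:
  assumes w: "w \<in> carrier (completed_sum I W)"
  shows "cutoff I W A w \<in> carrier (completed_sum I W)"
proof -
  have "finite {i \<in> I. e \<le> vnorm (W i) (cutoff I W A w i)}" if "0 < e" for e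
  proof (rule finite_subset)
    show "finite {i \<in> I. e \<le> vnorm (W i) (w i)}" using w that by (simp add: carrier_completed_sum)
    show "{i \<in> I. e \<le> vnorm (W i) (cutoff I W A w i)} \<subseteq> {i \<in> I. e \<le> vnorm (W i) (w i)}"
      using that by (auto simp: cutoff_def norm_zero W split: if_splits)
  qed
  then show ?thesis using w by (auto simp: carrier_completed_sum intro!: cutoff_closed W)
qed

text \<open>The supports run through intervals shrinking to an irrational point of the given open set. The
  coordinates outside of a finite set then contribute little to the norm of \<open>\<phi> f\<close>, hence little to
  the norm, let alone to the oscillation, of its image under \<open>\<psi>\<close>.\<close>

theorem fragmenting_completed_sum: "fragmenting v (completed_sum I W)"
proof (subst completed_sum_eq_subproduct, rule fragmenting_subproduct)
  show "carrier (completed_sum I W) \<subseteq> carrier (bounded_product I W)"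
    by (auto simp: carrier_completed_sum)
  show "cutoff I W A w \<in> carrier (completed_sum I W)" if "w \<in> carrier (completed_sum I W)" for A w
    using that by (rule cutoff_completed_sum_closed)
  show "single I W i x \<in> carrier (completed_sum I W)" if "i \<in> I" "x \<in> carrier (W i)" for i x
  proof -
    have "finite {j \<in> I. e \<le> vnorm (W j) (single I W i x j)}" if "0 < e" for e
      by (rule finite_subset [of _ "{i}"]) (use that in \<open>auto simp: single_def norm_zero W split: if_splits\<close>)
    then show ?thesis using that by (auto simp: carrier_completed_sum intro!: single_closed W)
  qed
next
  fix \<phi> \<psi> and e :: real and D :: "real set"
  assume "bounded_linear_map CQ (subproduct I W (carrier (completed_sum I W))) \<phi>"
    and "bounded_linear_map (subproduct I W (carrier (completed_sum I W))) CQ \<psi>"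
    and "0 < e" "open D" "D \<noteq> {}"
  then have \<phi>: "bounded_linear_map CQ (completed_sum I W) \<phi>"
    and \<psi>: "bounded_linear_map (completed_sum I W) CQ \<psi>"
    by (simp_all flip: completed_sum_eq_subproduct)
  obtain q d where q: "q \<in> \<rat>" "0 < d" "ball q d \<subseteq> D"
    using open_nonempty_obtains_rat [OF \<open>open D\<close> \<open>D \<noteq> {}\<close>] .
  \<comment> \<open>The intervals shrink to an irrational point, so every rational point leaves them.\<close>
  obtain r where r: "q < r" "r < q + d" "r \<notin> \<rat>" using irrational_between [of q "q + d"] q(2) by auto
  define B where "B n = {r<..<r + (q + d - r) / real (Suc n)}" for n
  have B_nonempty: "B n \<noteq> {}" for n
  proof -
    have "0 < (q + d - r) / real (Suc n)" using r(2) by simp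
    then show ?thesis by (simp add: B_def del: of_nat_Suc)
  qed
  have B_D: "B n \<subseteq> D" for n
  proof -
    have "(q + d - r) / real (Suc n) \<le> q + d - r"
      using divide_left_mono [of 1 "real (Suc n)" "q + d - r"] r(2) by simp
    then have "B n \<subseteq> ball q d" using r(1) by (auto simp: B_def dist_real_def)
    then show ?thesis using q(3) by blast
  qed
  have dec: "decseq B"
  proof (rule decseq_SucI)
    fix n
    have "(q + d - r) / real (Suc (Suc n)) \<le> (q + d - r) / real (Suc n)"
      using r(2) by (intro divide_left_mono) auto
    then show "B (Suc n) \<subseteq> B n" by (auto simp: B_def)
  qed
  have shrink: "\<exists>k. r + (q + d - r) / real (Suc k) < y" if "r < y" for y
  proof -
    have "0 < (y - r) / (q + d - r)" using that r(2) by simp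
    then obtain k where "inverse (real (Suc k)) < (y - r) / (q + d - r)" using reals_Archimedean by blast
    then have "(q + d - r) / real (Suc k) < y - r" using r(2) by (simp add: field_simps)
    then show ?thesis by (intro exI [of _ k]) simp
  qed
  have empty: "(\<Inter>n. B n) = {}"
  proof (rule ccontr)
    assume "(\<Inter>n. B n) \<noteq> {}"
    then obtain y where y: "\<And>n. y \<in> B n" by blast
    then have "r < y" using y [of 0] by (simp add: B_def)
    then obtain k where "r + (q + d - r) / real (Suc k) < y" using shrink by blast
    then show False using y [of k] by (simp add: B_def)
  qed
  have far: "\<exists>k. \<exists>d>0. \<forall>y. \<bar>y - x\<bar> < d \<longrightarrow> y \<notin> B k" if "x \<in> \<rat>" for x
  proof (cases "x < r")
    case True
    then show ?thesis by (intro exI [of _ 0] exI [of _ "r - x"]) (auto simp: B_def)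
  next
    case False
    then have "r < x" using that r(3) by (metis linorder_neqE_linordered_idom)
    then obtain k where "r + (q + d - r) / real (Suc k) < x" using shrink by blast
    then show ?thesis
      by (intro exI [of _ k] exI [of _ "x - (r + (q + d - r) / real (Suc k))"]) (auto simp: B_def)
  qed
  obtain C where C: "0 < C" "\<And>w. w \<in> carrier (completed_sum I W) \<Longrightarrow>
      vnorm CQ (\<psi> w) \<le> C * vnorm (completed_sum I W) w"
    using \<psi> unfolding bounded_linear_map_def by blast
  have "0 < e / C" using \<open>0 < e\<close> C(1) by simp
  from components_uniformly_small [OF \<phi> this dec empty far]
  obtain n F where F: "finite F" "F \<subseteq> I" and small: "\<And>i f. \<lbrakk>i \<in> I - F; f \<in> carrier CQ;
      vanishes_off \<rat> (\<lambda>_. scalars v) (B n) f\<rbrakk> \<Longrightarrow> vnorm (W i) (\<phi> f i) \<le> e / C * vnorm CQ f"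
    by blast
  have "osc_le v (B n) (e * vnorm CQ f) (\<psi> (cutoff I W (I - F) (\<phi> f)))"
    if f: "f \<in> carrier CQ" "vanishes_off \<rat> (\<lambda>_. scalars v) (B n) f" for f
  proof -
    let ?w = "cutoff I W (I - F) (\<phi> f)"
    have \<phi>f: "\<phi> f \<in> carrier (completed_sum I W)" using \<phi> f(1) by (simp add: bounded_linear_map_def)
    then have w: "?w \<in> carrier (completed_sum I W)" by (rule cutoff_completed_sum_closed)
    have "0 \<le> e / C * vnorm CQ f"
      using \<open>0 < e / C\<close> CQ_norm_nonneg [OF f(1)] by (intro mult_nonneg_nonneg) auto
    then have "vnorm (bounded_product I W) ?w \<le> e / C * vnorm CQ f"
      using \<phi>f small f by (intro norm_cutoff_le W) (auto simp: carrier_completed_sum)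
    then have "C * vnorm (completed_sum I W) ?w \<le> C * (e / C * vnorm CQ f)"
      unfolding completed_sum_def using C(1) by (intro mult_left_mono) auto
    then have "vnorm CQ (\<psi> ?w) \<le> e * vnorm CQ f" using C(1) C(2) [OF w] by simp
    moreover have "\<psi> ?w \<in> carrier CQ" using \<psi> w by (simp add: bounded_linear_map_def)
    ultimately show ?thesis using osc_le_subset [OF osc_le_norm order_refl] by blast
  qed
  then show "\<exists>F E. finite F \<and> F \<subseteq> I \<and> open E \<and> E \<noteq> {} \<and> E \<subseteq> D \<and>
      (\<forall>f\<in>carrier CQ. vanishes_off \<rat> (\<lambda>_. scalars v) E f \<longrightarrow>
         osc_le v E (e * vnorm CQ f) (\<psi> (cutoff I W (I - F) (\<phi> f))))"
    using F B_nonempty B_D by (intro exI [of _ F] exI [of _ "B n"]) (auto simp: B_def)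
qed

text \<open>The Chase lemma for the seminorms that measure the difference between the values of \<open>\<psi> w\<close> at
  \<open>q\<close> and at points \<open>x n\<close> that converge to \<open>q\<close>. They tend to \<open>0\<close> because \<open>\<psi> w\<close> is
  continuous.\<close>

lemma functions_uniformly_continuous_at:
  assumes \<psi>: "bounded_linear_map (bounded_product I W) CQ \<psi>" and "0 < \<epsilon>" and q: "q \<in> \<rat>"
    and B: "decseq B" "(\<Inter>n. B n) = {}"
  shows "\<exists>n. \<exists>d>0. \<forall>w\<in>carrier (bounded_product I W). vanishes_off I W (B n) w \<longrightarrow>
    (\<forall>x\<in>\<rat>. \<bar>x - q\<bar> < d \<longrightarrow> v (\<psi> w x - \<psi> w q) \<le> \<epsilon> * vnorm (bounded_product I W) w)"
proof (rule ccontr)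
  assume no: "\<not> ?thesis"
  have "\<exists>x\<in>\<rat>. \<bar>x - q\<bar> < 1 / real (Suc n) \<and> (\<exists>w\<in>carrier (bounded_product I W).
      vanishes_off I W (B n) w \<and> \<epsilon> * vnorm (bounded_product I W) w < v (\<psi> w x - \<psi> w q))" for n
  proof -
    have "0 < 1 / real (Suc n)" by simp
    then show ?thesis using no by (meson not_le)
  qed
  then obtain x where x: "\<And>n. x n \<in> \<rat>" "\<And>n. \<bar>x n - q\<bar> < 1 / real (Suc n)"
    and bad: "\<And>n. \<exists>w\<in>carrier (bounded_product I W). vanishes_off I W (B n) w \<and>
      \<epsilon> * vnorm (bounded_product I W) w < v (\<psi> w (x n) - \<psi> w q)"
    by metis
  define P where "P n w = v (\<psi> w (x n) - \<psi> w q)" for n w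
  obtain C where C: "\<And>w. w \<in> carrier (bounded_product I W) \<Longrightarrow>
      vnorm CQ (\<psi> w) \<le> C * vnorm (bounded_product I W) w"
    using \<psi> unfolding bounded_linear_map_def by blast
  have \<psi>_CQ: "\<psi> w \<in> carrier CQ" if "w \<in> carrier (bounded_product I W)" for w
    using \<psi> that by (simp add: bounded_linear_map_def)
  have \<psi>_add: "\<psi> (w \<oplus>\<^bsub>bounded_product I W\<^esub> w') y = \<psi> w y + \<psi> w' y"
    if "w \<in> carrier (bounded_product I W)" "w' \<in> carrier (bounded_product I W)" "y \<in> \<rat>" for w w' y
    using \<psi> that by (simp add: bounded_linear_map_def)
  have "\<exists>n. \<forall>j\<ge>n. \<forall>w\<in>carrier (bounded_product I W). vanishes_off I W (B n) w \<longrightarrow>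
      P j w \<le> \<epsilon> * vnorm (bounded_product I W) w"
  proof (rule chase_subproduct [where C = C, OF W B])
    show "c \<odot>\<^bsub>bounded_product I W\<^esub> w \<in> carrier (bounded_product I W)"
      if "w \<in> carrier (bounded_product I W)" for c w
      using that by (intro smult_bounded_product_closed W)
    show "P j (c \<odot>\<^bsub>bounded_product I W\<^esub> w) = v c * P j w"
      if "w \<in> carrier (bounded_product I W)" for j c w
    proof -
      have "\<psi> (c \<odot>\<^bsub>bounded_product I W\<^esub> w) = c \<odot>\<^bsub>CQ\<^esub> \<psi> w"
        using \<psi> that by (simp add: bounded_linear_map_def)
      then show ?thesis using x(1) q by (simp add: P_def v_mult flip: right_diff_distrib)
    qed
    show "P j w \<le> C * vnorm (bounded_product I W) w" if "w \<in> carrier (bounded_product I W)" for j w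
      using osc_le_norm [OF \<psi>_CQ [OF that], of UNIV] C [OF that] x(1) [of j] q
      by (fastforce simp: P_def osc_le_def)
    show "P j w \<le> max (P j (w \<oplus>\<^bsub>bounded_product I W\<^esub> w')) (P j w')"
      if "w \<in> carrier (bounded_product I W)" "w' \<in> carrier (bounded_product I W)" for j w w'
      using v_add [of "\<psi> w (x j) + \<psi> w' (x j) - (\<psi> w q + \<psi> w' q)" "- (\<psi> w' (x j) - \<psi> w' q)"]
      unfolding v_minus by (simp add: P_def \<psi>_add that x(1) q algebra_simps)
    show "P j w' \<le> max (P j (w \<oplus>\<^bsub>bounded_product I W\<^esub> w')) (P j w)"
      if "w \<in> carrier (bounded_product I W)" "w' \<in> carrier (bounded_product I W)" for j w w'
      using v_add [of "\<psi> w (x j) + \<psi> w' (x j) - (\<psi> w q + \<psi> w' q)" "- (\<psi> w (x j) - \<psi> w q)"]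
      unfolding v_minus by (simp add: P_def \<psi>_add that x(1) q algebra_simps)
    show "(\<lambda>j. P j w) \<longlonglongrightarrow> 0" if w: "w \<in> carrier (bounded_product I W)" for w
    proof (rule LIMSEQ_I)
      fix e :: real assume "0 < e"
      then obtain d where d: "0 < d" "\<And>y. \<lbrakk>y \<in> \<rat>; \<bar>y - q\<bar> < d\<rbrakk> \<Longrightarrow> v (\<psi> w y - \<psi> w q) < e"
        using CQ_continuous [OF \<psi>_CQ [OF w] q] unfolding continuous_at_rat_def by blast
      obtain m where m: "inverse (real (Suc m)) < d" using reals_Archimedean [OF d(1)] by blast
      have "P n w < e" if "m \<le> n" for n
      proof -
        have "1 / real (Suc n) \<le> 1 / real (Suc m)" using that by (intro divide_left_mono) auto
        then have "\<bar>x n - q\<bar> < d" using x(2) [of n] m by (simp add: inverse_eq_divide)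
        then show ?thesis using d(2) x(1) by (simp add: P_def)
      qed
      then show "\<exists>m. \<forall>n\<ge>m. norm (P n w - 0) < e" by (auto simp: P_def)
    qed
    show "r m \<in> carrier (bounded_product I W)"
      if "\<And>m. r m \<in> carrier (bounded_product I W)" for r m by (rule that)
  qed (assumption | rule order_refl \<open>0 < \<epsilon>\<close>)+
  then obtain n where "\<And>w. \<lbrakk>w \<in> carrier (bounded_product I W); vanishes_off I W (B n) w\<rbrakk>
      \<Longrightarrow> P n w \<le> \<epsilon> * vnorm (bounded_product I W) w" by blast
  then show False using bad [of n] by (force simp: P_def)
qed

text \<open>Fix a rational point \<open>q\<close> and call a set of indices null if \<open>\<psi>\<close> maps the families supported in it
  to functions that are almost constant near \<open>q\<close>, uniformly on the unit ball. The null sets form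
  an ideal, and by the preceding lemma a decreasing sequence of sets with empty intersection
  reaches it. As \<open>I\<close> is not measurable, the complement of some finite set is null.\<close>

theorem fragmenting_bounded_product:
  assumes I: "\<not> omega1_measurable I"
  shows "fragmenting v (bounded_product I W)"
proof (subst bounded_product_eq_subproduct, rule fragmenting_subproduct)
  show "cutoff I W A w \<in> carrier (bounded_product I W)" if "w \<in> carrier (bounded_product I W)" for A w
    using that by (intro cutoff_closed W)
  show "single I W i x \<in> carrier (bounded_product I W)" if "i \<in> I" "x \<in> carrier (W i)" for i x
    using that by (intro single_closed W)
next
  fix \<phi> \<psi> and e :: real and D :: "real set"
  assume "bounded_linear_map CQ (subproduct I W (carrier (bounded_product I W))) \<phi>"
    and "bounded_linear_map (subproduct I W (carrier (bounded_product I W))) CQ \<psi>"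
    and "0 < e" "open D" "D \<noteq> {}"
  then have \<phi>: "bounded_linear_map CQ (bounded_product I W) \<phi>"
    and \<psi>: "bounded_linear_map (bounded_product I W) CQ \<psi>"
    by (simp_all flip: bounded_product_eq_subproduct)
  obtain C where C: "0 < C" "\<And>f. f \<in> carrier CQ \<Longrightarrow> vnorm (bounded_product I W) (\<phi> f) \<le> C * vnorm CQ f"
    using \<phi> unfolding bounded_linear_map_def by blast
  have "0 < e / C" using \<open>0 < e\<close> C(1) by simp
  obtain q d0 where q: "q \<in> \<rat>" "0 < d0" "ball q d0 \<subseteq> D"
    using open_nonempty_obtains_rat [OF \<open>open D\<close> \<open>D \<noteq> {}\<close>] .
  define null where "null A \<longleftrightarrow> (\<exists>d>0. \<forall>w\<in>carrier (bounded_product I W). vanishes_off I W A w \<longrightarrow>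
    (\<forall>x\<in>\<rat>. \<bar>x - q\<bar> < d \<longrightarrow> v (\<psi> w x - \<psi> w q) \<le> e / C * vnorm (bounded_product I W) w))" for A
  have null_mono: "null A" if "null A'" "A \<subseteq> A'" for A A'
  proof -
    have "vanishes_off I W A' w" if "vanishes_off I W A w" for w
      using that \<open>A \<subseteq> A'\<close> by (auto simp: vanishes_off_def)
    then show ?thesis using \<open>null A'\<close> unfolding null_def by meson
  qed
  have null_union: "null (A \<union> A')" if "null A" "null A'" for A A'
  proof -
    let ?\<Pi> = "bounded_product I W"
    obtain d where d: "0 < d" "\<And>w x. \<lbrakk>w \<in> carrier ?\<Pi>; vanishes_off I W A w; x \<in> \<rat>; \<bar>x - q\<bar> < d\<rbrakk>
        \<Longrightarrow> v (\<psi> w x - \<psi> w q) \<le> e / C * vnorm ?\<Pi> w"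
      using \<open>null A\<close> unfolding null_def by blast
    obtain d' where d': "0 < d'" "\<And>w x. \<lbrakk>w \<in> carrier ?\<Pi>; vanishes_off I W A' w; x \<in> \<rat>; \<bar>x - q\<bar> < d'\<rbrakk>
        \<Longrightarrow> v (\<psi> w x - \<psi> w q) \<le> e / C * vnorm ?\<Pi> w"
      using \<open>null A'\<close> unfolding null_def by blast
    have "v (\<psi> w x - \<psi> w q) \<le> e / C * vnorm ?\<Pi> w"
      if w: "w \<in> carrier ?\<Pi>" "vanishes_off I W (A \<union> A') w" and x: "x \<in> \<rat>" "\<bar>x - q\<bar> < min d d'" for w x
    proof -
      \<comment> \<open>The second set may meet the first one, so the family is split along \<open>A\<close> and its complement.\<close>
      define a a' where "a = cutoff I W A w" and "a' = cutoff I W (- A) w"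
      have a: "a \<in> carrier ?\<Pi>" "a' \<in> carrier ?\<Pi>" using w(1) by (auto simp: a_def a'_def intro!: cutoff_closed W)
      have norm: "vnorm ?\<Pi> a \<le> vnorm ?\<Pi> w" "vnorm ?\<Pi> a' \<le> vnorm ?\<Pi> w"
        unfolding a_def a'_def using component_le_norm [OF w(1)] norm_bounded_product_nonneg [OF w(1)]
        by (intro norm_cutoff_le W w(1); auto)+
      have "w = cutoff I W (A \<union> - A) w" using w(1) by (intro cutoff_id [symmetric]) (auto simp: vanishes_off_def)
      also have "\<dots> = a \<oplus>\<^bsub>?\<Pi>\<^esub> a'" unfolding a_def a'_def using w(1) by (intro cutoff_split W) auto
      finally have "\<psi> w = \<psi> a \<oplus>\<^bsub>CQ\<^esub> \<psi> a'" using \<psi> a by (metis bounded_linear_map_def)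
      then have "\<psi> w x - \<psi> w q = (\<psi> a x - \<psi> a q) + (\<psi> a' x - \<psi> a' q)" using x(1) q(1) by simp
      also have "v \<dots> \<le> max (v (\<psi> a x - \<psi> a q)) (v (\<psi> a' x - \<psi> a' q))" by (rule v_add)
      finally have le: "v (\<psi> w x - \<psi> w q) \<le> max (v (\<psi> a x - \<psi> a q)) (v (\<psi> a' x - \<psi> a' q))" .
      have "v (\<psi> a x - \<psi> a q) \<le> e / C * vnorm ?\<Pi> a"
        using d(2) [OF a(1) _ x(1)] x(2) by (simp add: a_def vanishes_off_def cutoff_def)
      also have "\<dots> \<le> e / C * vnorm ?\<Pi> w" by (intro mult_left_mono norm less_imp_le [OF \<open>0 < e / C\<close>])
      finally have 1: "v (\<psi> a x - \<psi> a q) \<le> e / C * vnorm ?\<Pi> w" .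
      have "v (\<psi> a' x - \<psi> a' q) \<le> e / C * vnorm ?\<Pi> a'"
        using d'(2) [OF a(2) _ x(1)] x(2) w(2) by (auto simp: a'_def vanishes_off_def cutoff_def)
      also have "\<dots> \<le> e / C * vnorm ?\<Pi> w" by (intro mult_left_mono norm less_imp_le [OF \<open>0 < e / C\<close>])
      finally show ?thesis using 1 le by linarith
    qed
    then show ?thesis unfolding null_def using d(1) d'(1) by (intro exI [of _ "min d d'"]) auto
  qed
  have "\<exists>F. finite F \<and> null (I - F)"
  proof (rule ccontr)
    assume no: "\<not> ?thesis"
    have "\<exists>n. null (B n)" if "decseq B" "(\<Inter>n. B n) = {}" for B
      using functions_uniformly_continuous_at [OF \<psi> \<open>0 < e / C\<close> q(1) that] unfolding null_def .
    then have "omega1_measurable I"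
      using null_mono null_union no by (intro omega1_measurable_if_null_ideal [of null]) auto
    then show False using I by blast
  qed
  then obtain F where "finite F" "null (I - F)" by blast
  then obtain d where d: "0 < d" "\<And>w x. \<lbrakk>w \<in> carrier (bounded_product I W); vanishes_off I W (I - F) w;
      x \<in> \<rat>; \<bar>x - q\<bar> < d\<rbrakk> \<Longrightarrow> v (\<psi> w x - \<psi> w q) \<le> e / C * vnorm (bounded_product I W) w"
    unfolding null_def by blast
  define E where "E = ball q (min d d0)"
  have cutoff_eq: "cutoff I W (I - (F \<inter> I)) w = cutoff I W (I - F) w" for w
    by (auto simp: cutoff_def fun_eq_iff)
  have "osc_le v E (e * vnorm CQ f) (\<psi> (cutoff I W (I - (F \<inter> I)) (\<phi> f)))" if f: "f \<in> carrier CQ" for f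
  proof (rule osc_le_of_center [of _ _ q])
    fix x assume x: "x \<in> E \<inter> \<rat>"
    let ?w = "cutoff I W (I - F) (\<phi> f)"
    have \<phi>f: "\<phi> f \<in> carrier (bounded_product I W)" using \<phi> f by (simp add: bounded_linear_map_def)
    have "v (\<psi> ?w x - \<psi> ?w q) \<le> e / C * vnorm (bounded_product I W) ?w"
      using x by (intro d(2) cutoff_closed W \<phi>f)
        (auto simp: E_def dist_real_def abs_minus_commute vanishes_off_def cutoff_def)
    also have "\<dots> \<le> e / C * (C * vnorm CQ f)"
    proof (rule mult_left_mono)
      have "vnorm (bounded_product I W) ?w \<le> vnorm (bounded_product I W) (\<phi> f)"
        using component_le_norm [OF \<phi>f] norm_bounded_product_nonneg [OF \<phi>f]
        by (intro norm_cutoff_le W \<phi>f) auto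
      then show "vnorm (bounded_product I W) ?w \<le> C * vnorm CQ f" using C(2) [OF f] by linarith
    qed (use \<open>0 < e / C\<close> in simp)
    also have "\<dots> = e * vnorm CQ f" using C(1) by simp
    finally show "v (\<psi> (cutoff I W (I - (F \<inter> I)) (\<phi> f)) x - \<psi> (cutoff I W (I - (F \<inter> I)) (\<phi> f)) q)
        \<le> e * vnorm CQ f" by (simp add: cutoff_eq)
  qed
  moreover have "open E" "E \<noteq> {}" "E \<subseteq> D" using q d(1) by (auto simp: E_def subset_iff)
  ultimately show "\<exists>F E. finite F \<and> F \<subseteq> I \<and> open E \<and> E \<noteq> {} \<and> E \<subseteq> D \<and>
      (\<forall>f\<in>carrier CQ. vanishes_off \<rat> (\<lambda>_. scalars v) E f \<longrightarrow>
         osc_le v E (e * vnorm CQ f) (\<psi> (cutoff I W (I - F) (\<phi> f))))"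
    using \<open>finite F\<close> by (intro exI [of _ "F \<inter> I"] exI [of _ E]) auto
qed simp

end

section \<open>The Reid class\<close>

lemma fragmenting_isometric_iso:
  assumes V: "ultranormed v V" and iso: "V \<cong>\<^sub>B Z" and Z: "fragmenting v Z"
  shows "fragmenting v V"
proof -
  obtain h where h: "h \<in> Group.iso (add_monoid V) (add_monoid Z)"
    and h_smult: "\<And>c x. x \<in> carrier V \<Longrightarrow> h (c \<odot>\<^bsub>V\<^esub> x) = c \<odot>\<^bsub>Z\<^esub> h x"
    and h_norm: "\<And>x. x \<in> carrier V \<Longrightarrow> vnorm Z (h x) = vnorm V x"
    using iso unfolding isometric_iso_def by blast
  have bij: "bij_betw h (carrier V) (carrier Z)" and h_add: "\<And>x y. \<lbrakk>x \<in> carrier V; y \<in> carrier V\<rbrakk>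
      \<Longrightarrow> h (x \<oplus>\<^bsub>V\<^esub> y) = h x \<oplus>\<^bsub>Z\<^esub> h y"
    using h by (auto simp: Group.iso_def hom_def)
  have h_in: "h x \<in> carrier Z" if "x \<in> carrier V" for x using bij that by (auto simp: bij_betw_def)
  define g where "g = inv_into (carrier V) h"
  have gh: "g (h x) = x" if "x \<in> carrier V" for x
    using bij that by (simp add: g_def bij_betw_def)
  have Z_E: "\<exists>x\<in>carrier V. z = h x" if "z \<in> carrier Z" for z using bij that by (auto simp: bij_betw_def)
  have h_map: "bounded_linear_map V Z h"
    unfolding bounded_linear_map_def using h_in h_add h_smult h_norm by (auto intro!: exI [of _ 1])
  have "g z \<in> carrier V" "vnorm V (g z) = vnorm Z z" "g (c \<odot>\<^bsub>Z\<^esub> z) = c \<odot>\<^bsub>V\<^esub> g z"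
    if "z \<in> carrier Z" for z c
  proof -
    obtain x where x: "x \<in> carrier V" "z = h x" using Z_E [OF \<open>z \<in> carrier Z\<close>] by blast
    then show "g z \<in> carrier V" "vnorm V (g z) = vnorm Z z" by (simp_all add: gh h_norm)
    show "g (c \<odot>\<^bsub>Z\<^esub> z) = c \<odot>\<^bsub>V\<^esub> g z"
      using x gh [OF smult_closed [OF V x(1), of c]] by (simp add: gh h_smult)
  qed
  moreover have "g (z \<oplus>\<^bsub>Z\<^esub> z') = g z \<oplus>\<^bsub>V\<^esub> g z'" if "z \<in> carrier Z" "z' \<in> carrier Z" for z z'
  proof -
    obtain x x' where "x \<in> carrier V" "z = h x" "x' \<in> carrier V" "z' = h x'" 
      using Z_E \<open>z \<in> carrier Z\<close> \<open>z' \<in> carrier Z\<close> by metis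
    then show ?thesis using gh [OF add_closed [OF V, of x x']] by (simp add: gh h_add)
  qed
  ultimately have g_map: "bounded_linear_map Z V g"
    unfolding bounded_linear_map_def by (auto intro!: exI [of _ 1])
  show ?thesis
    unfolding fragmenting_def
  proof (intro allI impI)
    fix \<phi> \<psi> assume \<phi>: "bounded_linear_map CQ V \<phi>" and \<psi>: "bounded_linear_map V CQ \<psi>"
    have "locally_small v ((\<psi> \<circ> g) \<circ> (h \<circ> \<phi>))"
      using Z bounded_linear_map_comp [OF \<phi> h_map] bounded_linear_map_comp [OF g_map \<psi>]
      unfolding fragmenting_def by blast
    moreover have "((\<psi> \<circ> g) \<circ> (h \<circ> \<phi>)) f = (\<psi> \<circ> \<phi>) f" if "f \<in> carrier CQ" for f
      using \<phi> that by (simp add: bounded_linear_map_def gh)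
    ultimately show "locally_small v (\<psi> \<circ> \<phi>)" unfolding locally_small_def by simp
  qed
qed

lemma fragmenting_F_class:
  assumes "V \<in> F_class v"
  shows "fragmenting v V"
proof -
  obtain n where "banach_space v V" and iso: "V \<cong>\<^sub>B max_norm_space v n"
    using assms by (auto simp: F_class_def)
  have "fragmenting v (max_norm_space v n)"
    unfolding max_norm_space_eq_bounded_product
    by (rule fragmenting_bounded_product)
      (simp_all add: ultranormed_scalars fragmenting_scalars omega1_measurable_def countable_finite)
  then show ?thesis
    using fragmenting_isometric_iso iso ultranormed_if_banach_space [OF \<open>banach_space v V\<close>] by blast
qed

lemma fragmenting_step:
  fixes \<kappa> :: "'i size_bound" and L :: "('k, 'u) normed_module set"
  assumes "infinite_bound \<kappa>" "nonmeasurability_condition \<kappa>"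
    and L: "\<And>W. W \<in> L \<Longrightarrow> ultranormed v W \<and> fragmenting v W"
    and "V \<in> Pi_step v \<kappa> L \<union> Sigma_step v \<kappa> L"
  shows "ultranormed v V \<and> fragmenting v V"
proof
  show V: "ultranormed v V"
    using assms(4) by (auto simp: Pi_step_def Sigma_step_def F_class_def intro: ultranormed_if_banach_space)
  consider "V \<in> F_class v"
    | (Pi) I :: "'i set" and W where "size_less I \<kappa>" "\<forall>i\<in>I. W i \<in> L" "V \<cong>\<^sub>B bounded_product I W"
    | (Sigma) I :: "'i set" and W where "\<forall>i\<in>I. W i \<in> L" "V \<cong>\<^sub>B completed_sum I W"
    using assms(4) unfolding Pi_step_def Sigma_step_def by blast
  then show "fragmenting v V"
  proof cases
    case 1
    then show ?thesis by (rule fragmenting_F_class)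
  next
    case Pi
    have "fragmenting v (bounded_product I W)"
      using L Pi(2) not_omega1_measurable_if_size_less [OF assms(1,2) Pi(1)]
      by (intro fragmenting_bounded_product) auto
    then show ?thesis using fragmenting_isometric_iso [OF V Pi(3)] by blast
  next
    case Sigma
    have "fragmenting v (completed_sum I W)"
      using L Sigma(1) by (intro fragmenting_completed_sum) auto
    then show ?thesis using fragmenting_isometric_iso [OF V Sigma(2)] by blast
  qed
qed

lemma fragmenting_reid_stage:
  fixes \<kappa> :: "'i size_bound" and V :: "('k, 'u) normed_module" and \<alpha> :: "'o::wellorder"
  assumes "infinite_bound \<kappa>" "nonmeasurability_condition \<kappa>" "V \<in> reid_stage v \<kappa> \<alpha>"
  shows "ultranormed v V \<and> fragmenting v V"
  using assms(3)
proof (induction \<alpha> arbitrary: V rule: less_induct)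
  case (less \<alpha>)
  show ?case
    using less.prems unfolding reid_stage.simps [of v \<kappa> \<alpha>]
    by (rule fragmenting_step [OF assms(1,2), rotated]) (use less.IH in auto)
qed

theorem fragmenting_reid_class:
  fixes \<kappa> :: "'i size_bound"
  assumes "infinite_bound \<kappa>" "nonmeasurability_condition \<kappa>"
    and "V \<in> reid_class TYPE('u) TYPE('o::wellorder) v \<kappa>"
  shows "fragmenting v V"
proof -
  obtain \<alpha> :: 'o and L :: "('k, 'u) normed_module set"
    where L: "L = (\<Union>\<beta>\<in>{..<\<alpha>}. reid_stage v \<kappa> \<beta>)" and V: "V \<in> Pi_step v \<kappa> L \<union> Sigma_step v \<kappa> L"
    using assms(3) unfolding reid_class_def Let_def by blast
  have "ultranormed v V \<and> fragmenting v V"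
    by (rule fragmenting_step [OF assms(1,2) _ V]) (use fragmenting_reid_stage [OF assms(1,2)] L in blast)
  then show ?thesis by blast
qed

end

lemma dense_valuation_if_complete_valuation:
  assumes "complete_valuation v" "closure (range v) = {0..}"
  shows "dense_valuation v"
proof
  fix p q :: real assume "0 < p" "p < q"
  then have "(p + q) / 2 \<in> closure (range v)" using assms(2) by simp
  moreover have "0 < (q - p) / 2" using \<open>p < q\<close> by simp
  ultimately obtain t where t: "dist (v t) ((p + q) / 2) < (q - p) / 2"
    unfolding closure_approachable by blast
  then have "p < v t" "v t < q" by (auto simp: dist_real_def abs_less_iff field_simps)
  then show "\<exists>t. p < v t \<and> v t < q" by blast
qed (use assms(1) in \<open>auto simp: complete_valuation_def\<close>)

theorem theorem6p1:
  fixes v :: "'k::field \<Rightarrow> real" and \<kappa> :: "'i size_bound"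
  assumes "complete_valuation v"
    and "closure (range v) = {0..}"
    and "infinite_bound \<kappa>"
    and "nonmeasurability_condition \<kappa>"
  shows "bounded_continuous v (top_of_set (\<rat> :: real set))
           \<notin> reid_class TYPE('u) TYPE('o::wellorder) v \<kappa>"
proof -
  interpret dense_valuation v using assms(1,2) by (rule dense_valuation_if_complete_valuation)
  show ?thesis using fragmenting_reid_class [OF assms(3,4)] not_fragmenting_CQ by blast
qed

end
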